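(* Let $U\subset\mathbb{C}^n$ be a simply-connected domain and consider an extended Okubo system $$dY=-(zI_n-T)^{-1}\bigl(dz\,I_n+\tilde\Omega\bigr)B_\infty Y\quad\text{on }\mathbb{P}^1\times U,\qquad B_\infty=\operatorname{diag}[\lambda_1,\dots,\lambda_n].$$ This system induces a Saito structure on $U$ if and only if $$dT_{n1}\wedge dT_{n2}\wedge\cdots\wedge dT_{nn}\neq 0\quad\text{at every point of }U.$$ If this condition is satisfied, then the functions $t_j:=-(\lambda_j-\lambda_n+1)^{-1}T_{nj}$, $1\le j\le n$, give a flat coordinate system on $U$ for this Saito structure.
   Context: **Extended Okubo system.** $T$ is an $n\times n$ matrix of holomorphic functions on $U$, $\tilde\Omega$ an $n\times n$ matrix of holomorphic 1-forms on $U$, and $B_\infty$ a constant matrix, subject to: (A1) $T$ is diagonalizable at generic points of $U$; (A2) $B_\infty=\operatorname{diag}[\lambda_1,\dots,\lambda_n]$ with $\lambda_i-\lambda_j\notin\mathbb{Z}\setminus\{0\}$ for $i\ne j$; (A3) writing $H(z)=\det(zI_n-T)=\prod_i(z-z_i)=z^n-S_1z^{n-1}+\cdots+(-1)^nS_n$, one has $dS_1\wedge\cdots\wedge dS_n\ne0$ at generic points of $U$; (A4) let $\Delta_H\subset U$ be the union of the zero set of the discriminant $\prod_{i<j}(z_i-z_j)^2$ and of $\{dS_1\wedge\cdots\wedge dS_n=0\}$; in the partial fraction expansion $-(zI_n-T)^{-1}B_\infty=\sum_{i=1}^n\frac{B_i}{z-z_i}$ on $U\setminus\Delta_H$ one has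 $\operatorname{tr}B_i\ne\pm1$ for all $i$. The Pfaffian system is called an extended Okubo system if moreover $$[T,\tilde\Omega]=O,\quad \tilde\Omega\wedge\tilde\Omega=O,\quad dT+\tilde\Omega+[\tilde\Omega,B_\infty]=O,\quad d\tilde\Omega=O.$$ **Saito structure (without metric).** On an $n$-dimensional complex manifold $M$ it is a tuple $(\nabla^0,\Phi,e,E)$: $\nabla^0$ is a flat torsion-free holomorphic connection on $TM$; $\Phi$ is a symmetric Higgs field, i.e. an $\operatorname{End}(TM)$-valued holomorphic 1-form such that $X\star Y:=\Phi_X(Y)$ is commutative and associative; $e,E$ are global vector fields; such that (a) the meromorphic connection $\nabla=\pi^*\nabla^0+\frac{\pi^*\Phi}{z}-\bigl(\frac{\Phi(E)}{z}+\nabla^0E\bigr)\frac{dz}{z}$ on $\pi^*TM$ over $\mathbb{P}^1\times M$ ($\pi:\mathbb{P}^1\times M\to M$ the projection) is integrable, where $\Phi(E)$ is the endomorphism $X\mapsto\Phi_X(E)$ and $\nabla^0E$ the endomorphism $X\mapsto\nabla^0_XE$; (b) $\nabla^0e=0$ and $\Phi_e=\mathrm{Id}$. A flat coordinate system is a system of coordinates $(t_1,\dots,t_n)$ with $\nabla^0(\partial_{t_i})=0$ for all $i$ (on $U$: functions $t_1,\dots,t_n$ with nowhere vanishing Jacobian whose associated fields $\partial_{t_i}$ are $\nabla^0$-horizontal). **Induced Saito structure.** Let $\mathbf e_1,\dots,\mathbf e_n$ be the standard frame of the trivial bundle $U\times\mathbb{C}^n$, with trivial flat connection $d$, and define endomorphisms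 by $\tilde\Omega^t_X(\mathbf e_j)=\sum_i\tilde\Omega_{ji}(X)\mathbf e_i$, $T^t(\mathbf e_j)=\sum_iT_{ji}\mathbf e_i$. Define $\varphi:TU\to U\times\mathbb{C}^n$ by $\varphi(X)=\tilde\Omega^t_X(\mathbf e_n)=\sum_i\tilde\Omega_{ni}(X)\mathbf e_i$. The extended Okubo system is said to induce a Saito structure on $U$ if $\varphi$ is an isomorphism of bundles on $U$ (so that $\mathbf e_n$ is a primitive section) and the data $\nabla^0=\varphi^{-1}\circ d\circ\varphi$, $\Phi=\varphi^{-1}\circ\tilde\Omega^t\circ\varphi$, $e=\varphi^{-1}(\mathbf e_n)$, $E=-\varphi^{-1}(T^t\mathbf e_n)$ form a Saito structure on $U$. *)

theory Defs
  imports "HOL-Analysis.Analysis" "HOL-Computational_Algebra.Polynomial"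
begin

text \<open>
  The index type is a finite linear order, i.e. a copy of \<open>{1 < \<dots> < n}\<close>; the index \<open>n\<close> is its
  largest element.
\<close>

definition last_index :: "'n::{finite,linorder}" where
  "last_index = Max UNIV"


type_synonym 'n cvec = "(complex, 'n) vec"
type_synonym 'n cmat = "((complex, 'n) vec, 'n) vec"


section \<open>Holomorphic functions, fields and forms in several variables\<close>

text \<open>
  Complex differentiability in the open set \<open>S\<close> (the total real derivative exists and is
  complex linear).  The parameter \<open>sc\<close> is the complex scalar multiplication of the domain, which is
  either \<open>\<complex>\<^sup>n\<close> with \<^term>\<open>(*s)\<close> or \<open>\<complex> \<times> \<complex>\<^sup>n\<close> with \<open>scale_prod\<close>.
\<close>

definition scale_prod :: "complex \<Rightarrow> complex \<times> (complex^'n) \<Rightarrow> complex \<times> (complex^'n)" where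
  "scale_prod c w = (c * fst w, c *s snd w)"

definition holo :: "(complex \<Rightarrow> 'a \<Rightarrow> 'a) \<Rightarrow> ('a::real_normed_vector \<Rightarrow> complex) \<Rightarrow> 'a set \<Rightarrow> bool" where
  "holo sc f S \<longleftrightarrow>
     (\<forall>p\<in>S. \<exists>f'. (f has_derivative f') (at p) \<and> (\<forall>c v. f' (sc c v) = c * f' v))"

definition holo_map ::
  "(complex \<Rightarrow> 'a \<Rightarrow> 'a) \<Rightarrow> ('a::real_normed_vector \<Rightarrow> complex^'m) \<Rightarrow> 'a set \<Rightarrow> bool" where
  "holo_map sc F S \<longleftrightarrow> (\<forall>i. holo sc (\<lambda>p. F p $ i) S)"

text \<open>Holomorphic vector fields on an open subset of \<open>\<complex>\<^sup>n\<close> and of \<open>\<complex> \<times> \<complex>\<^sup>n\<close>.\<close>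

definition vector_field :: "(complex^'n) set \<Rightarrow> (complex^'n \<Rightarrow> complex^'n) \<Rightarrow> bool" where
  "vector_field U X \<longleftrightarrow> holo_map (*s) X U"

definition vector_field_prod ::
  "(complex \<times> (complex^'n)) set \<Rightarrow> (complex \<times> (complex^'n) \<Rightarrow> complex \<times> (complex^'n)) \<Rightarrow> bool" where
  "vector_field_prod S V \<longleftrightarrow>
     holo scale_prod (\<lambda>w. fst (V w)) S \<and> holo_map scale_prod (\<lambda>w. snd (V w)) S"

definition lie_bracket ::
  "('a::real_normed_vector \<Rightarrow> 'a) \<Rightarrow> ('a \<Rightarrow> 'a) \<Rightarrow> 'a \<Rightarrow> 'a" where
  "lie_bracket X Y p = frechet_derivative Y (at p) (X p) - frechet_derivative X (at p) (Y p)"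

text \<open>\<open>Om p v\<close> is the value of the matrix of 1-forms at the point \<open>p\<close> on the tangent vector \<open>v\<close>.\<close>

definition holo_matrix_form ::
  "(complex^'n) set \<Rightarrow> (complex^'n \<Rightarrow> complex^'n \<Rightarrow> complex^'m^'k) \<Rightarrow> bool" where
  "holo_matrix_form U Om \<longleftrightarrow>
     (\<forall>p\<in>U. \<forall>i j. Vector_Spaces.linear (*s) (*) (\<lambda>v. Om p v $ i $ j)) \<and>
     (\<forall>v i j. holo (*s) (\<lambda>p. Om p v $ i $ j) U)"

text \<open>\<open>d\<omega>(u,v) = u(\<omega>(v)) - v(\<omega>(u))\<close> for constant vector fields \<open>u, v\<close>.\<close>

definition ext_deriv ::
  "('a::real_normed_vector \<Rightarrow> 'a \<Rightarrow> 'b::real_normed_vector) \<Rightarrow> 'a \<Rightarrow> 'a \<Rightarrow> 'a \<Rightarrow> 'b" where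
  "ext_deriv \<omega> p u v =
     frechet_derivative (\<lambda>q. \<omega> q v) (at p) u - frechet_derivative (\<lambda>q. \<omega> q u) (at p) v"

text \<open>
  The wedge product of the covectors \<open>\<alpha>\<^sub>i\<close>, \<open>i \<in> I\<close>, as an alternating form:
  \<open>(\<And>\<^sub>i \<alpha>\<^sub>i)(v) = det (\<alpha>\<^sub>i (v\<^sub>j))\<close>.  The arguments \<open>v\<close> are indexed by \<open>I\<close> as well.
\<close>

definition wedge :: "'i set \<Rightarrow> ('i \<Rightarrow> 'v \<Rightarrow> complex) \<Rightarrow> ('i \<Rightarrow> 'v) \<Rightarrow> complex" where
  "wedge I \<alpha> = (\<lambda>v. \<Sum>\<pi> | \<pi> permutes I. of_int (sign \<pi>) * (\<Prod>i\<in>I. \<alpha> i (v (\<pi> i))))"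

text \<open>A property holds at generic points of \<open>U\<close> if it holds off a proper analytic subset of \<open>U\<close>.\<close>

definition analytic_subset :: "(complex^'n) set \<Rightarrow> (complex^'n) set \<Rightarrow> bool" where
  "analytic_subset U Z \<longleftrightarrow> Z \<subseteq> U \<and>
     (\<forall>p\<in>U. \<exists>W F. open W \<and> p \<in> W \<and> W \<subseteq> U \<and> finite F \<and> (\<forall>f\<in>F. holo (*s) f W) \<and>
        Z \<inter> W = {q\<in>W. \<forall>f\<in>F. f q = 0})"

definition generically :: "(complex^'n) set \<Rightarrow> (complex^'n \<Rightarrow> bool) \<Rightarrow> bool" where
  "generically U P \<longleftrightarrow> (\<exists>Z. analytic_subset U Z \<and> Z \<noteq> U \<and> (\<forall>p\<in>U - Z. P p))"


section \<open>Extended Okubo systems\<close>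

definition diag :: "('n \<Rightarrow> complex) \<Rightarrow> complex^'n^'n" where
  "diag d = (\<chi> i j. if i = j then d i else 0)"

definition diagonalizable :: "complex^'n^'n \<Rightarrow> bool" where
  "diagonalizable A \<longleftrightarrow> (\<exists>(P :: complex^'n^'n) d. invertible P \<and> A = P ** diag d ** matrix_inv P)"

text \<open>\<open>char_pol A = det (z I - A)\<close> as a polynomial in \<open>z\<close>.\<close>

definition char_pol :: "complex^'n^'n \<Rightarrow> complex poly" where
  "char_pol A = det (mat [:0, 1:] - map_matrix (\<lambda>c. [:c:]) A)"

text \<open>\<open>det (z I - A) = z\<^sup>n - S\<^sub>1 z\<^sup>n\<^sup>-\<^sup>1 + \<dots> + (-1)\<^sup>n S\<^sub>n\<close>, for \<open>1 \<le> k \<le> n\<close>.\<close>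

definition sym_coeff :: "nat \<Rightarrow> complex^'n^'n \<Rightarrow> complex" where
  "sym_coeff k A = (- 1) ^ k * coeff (char_pol A) (CARD('n) - k)"

text \<open>\<open>z\<close> lists the eigenvalues of \<open>A\<close> with multiplicity.\<close>

definition eigenvalues :: "complex^'n^'n \<Rightarrow> ('n \<Rightarrow> complex) \<Rightarrow> bool" where
  "eigenvalues A z \<longleftrightarrow> char_pol A = (\<Prod>i\<in>UNIV. [:- z i, 1:])"

definition discriminant :: "('n::{finite,linorder} \<Rightarrow> complex) \<Rightarrow> complex" where
  "discriminant z = (\<Prod>(i, j)\<in>{(i, j). i < j}. (z i - z j)\<^sup>2)"

text \<open>\<open>dS\<^sub>1 \<and> \<dots> \<and> dS\<^sub>n\<close> at the point \<open>p\<close>.\<close>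

definition dS_wedge :: "(complex^'n \<Rightarrow> complex^'n^'n) \<Rightarrow> complex^'n \<Rightarrow> (nat \<Rightarrow> complex^'n) \<Rightarrow> complex" where
  "dS_wedge T p =
     wedge {1..CARD('n)} (\<lambda>k. frechet_derivative (\<lambda>q. sym_coeff k (T q)) (at p))"

definition Delta_H ::
  "'n cvec set \<Rightarrow> ('n cvec \<Rightarrow> 'n cmat) \<Rightarrow> ('n::{finite,linorder}) cvec set" where
  "Delta_H U T =
     {p\<in>U. (\<exists>z. eigenvalues (T p) z \<and> discriminant z = 0) \<or> dS_wedge T p = (\<lambda>_. 0)}"

text \<open>\<open>- (w I - A)\<^sup>-\<^sup>1 B = \<Sum>\<^sub>i R\<^sub>i / (w - z\<^sub>i)\<close>, with \<open>mat c ** R\<close> in the role of \<open>c R\<close>.\<close>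

definition partial_fractions ::
  "complex^'n^'n \<Rightarrow> complex^'n^'n \<Rightarrow> ('n \<Rightarrow> complex) \<Rightarrow> ('n \<Rightarrow> complex^'n^'n) \<Rightarrow> bool" where
  "partial_fractions A B z R \<longleftrightarrow>
     (\<forall>w. w \<notin> range z \<longrightarrow>
        - (matrix_inv (mat w - A) ** B) = (\<Sum>i\<in>UNIV. mat (1 / (w - z i)) ** R i))"

text \<open>
  The extended Okubo system
  \<open>dY = - (z I - T)\<^sup>-\<^sup>1 (dz I + \<Omega>) B\<^sub>\<infinity> Y\<close>, \<open>B\<^sub>\<infinity> = diag [\<lambda>\<^sub>1,\<dots>,\<lambda>\<^sub>n]\<close>, is given by its data \<open>T\<close>, \<open>\<Omega>\<close>, \<open>\<lambda>\<close>.
  Off \<open>\<Delta>\<^sub>H\<close> the eigenvalues are distinct, so the residues \<open>R\<close> are determined by the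
  numbering \<open>z\<close> of the eigenvalues.
\<close>

definition extended_okubo ::
  "('n::{finite,linorder}) cvec set \<Rightarrow> ('n cvec \<Rightarrow> 'n cmat) \<Rightarrow>
   ('n cvec \<Rightarrow> 'n cvec \<Rightarrow> 'n cmat) \<Rightarrow> ('n \<Rightarrow> complex) \<Rightarrow> bool" where
  "extended_okubo U T Om lam \<longleftrightarrow>
     (\<forall>i j. holo (*s) (\<lambda>p. T p $ i $ j) U) \<and>
     holo_matrix_form U Om \<and>
     generically U (\<lambda>p. diagonalizable (T p)) \<and>
     (\<forall>i j. i \<noteq> j \<longrightarrow> lam i - lam j \<notin> \<int> - {0}) \<and>
     generically U (\<lambda>p. dS_wedge T p \<noteq> (\<lambda>_. 0)) \<and>
     (\<forall>p\<in>U - Delta_H U T. \<forall>z R.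
        eigenvalues (T p) z \<and> partial_fractions (T p) (diag lam) z R \<longrightarrow>
        (\<forall>i. trace (R i) \<noteq> 1 \<and> trace (R i) \<noteq> - 1)) \<and>
     (\<forall>p\<in>U. \<forall>u v.
        T p ** Om p v - Om p v ** T p = 0 \<and>
        Om p u ** Om p v - Om p v ** Om p u = 0 \<and>
        frechet_derivative T (at p) v + Om p v + (Om p v ** diag lam - diag lam ** Om p v) = 0 \<and>
        ext_deriv Om p u v = 0)"


section \<open>Saito structures (without metric) on an open subset of \<open>\<complex>\<^sup>n\<close>\<close>

text \<open>
  The tangent bundle of \<open>U\<close> is \<open>U \<times> \<complex>\<^sup>n\<close>.  As it is trivial, a connection is determined by its
  action on global holomorphic vector fields; \<open>D X Y\<close> stands for \<open>\<nabla>\<^sub>X Y\<close>.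
\<close>

type_synonym 'n conn =
  "(complex^'n \<Rightarrow> complex^'n) \<Rightarrow> (complex^'n \<Rightarrow> complex^'n) \<Rightarrow> complex^'n \<Rightarrow> complex^'n"

definition holo_connection :: "(complex^'n) set \<Rightarrow> 'n conn \<Rightarrow> bool" where
  "holo_connection U D \<longleftrightarrow>
     (\<forall>X Y. vector_field U X \<and> vector_field U Y \<longrightarrow> vector_field U (D X Y)) \<and>
     (\<forall>X X' Y. vector_field U X \<and> vector_field U X' \<and> vector_field U Y \<longrightarrow>
        (\<forall>p\<in>U. D (\<lambda>q. X q + X' q) Y p = D X Y p + D X' Y p)) \<and>
     (\<forall>f X Y. holo (*s) f U \<and> vector_field U X \<and> vector_field U Y \<longrightarrow>
        (\<forall>p\<in>U. D (\<lambda>q. f q *s X q) Y p = f p *s D X Y p)) \<and>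
     (\<forall>X Y Y'. vector_field U X \<and> vector_field U Y \<and> vector_field U Y' \<longrightarrow>
        (\<forall>p\<in>U. D X (\<lambda>q. Y q + Y' q) p = D X Y p + D X Y' p)) \<and>
     (\<forall>f X Y. holo (*s) f U \<and> vector_field U X \<and> vector_field U Y \<longrightarrow>
        (\<forall>p\<in>U. D X (\<lambda>q. f q *s Y q) p = frechet_derivative f (at p) (X p) *s Y p + f p *s D X Y p))"

definition flat_connection :: "(complex^'n) set \<Rightarrow> 'n conn \<Rightarrow> bool" where
  "flat_connection U D \<longleftrightarrow>
     (\<forall>X Y Z. vector_field U X \<and> vector_field U Y \<and> vector_field U Z \<longrightarrow>
        (\<forall>p\<in>U. D X (D Y Z) p - D Y (D X Z) p - D (lie_bracket X Y) Z p = 0))"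

definition torsion_free :: "(complex^'n) set \<Rightarrow> 'n conn \<Rightarrow> bool" where
  "torsion_free U D \<longleftrightarrow>
     (\<forall>X Y. vector_field U X \<and> vector_field U Y \<longrightarrow>
        (\<forall>p\<in>U. D X Y p - D Y X p = lie_bracket X Y p))"

text \<open>\<open>\<Phi> p u v\<close> is \<open>\<Phi>\<^sub>u v\<close> at the point \<open>p\<close>.\<close>

definition symmetric_higgs_field ::
  "(complex^'n) set \<Rightarrow> (complex^'n \<Rightarrow> complex^'n \<Rightarrow> complex^'n \<Rightarrow> complex^'n) \<Rightarrow> bool" where
  "symmetric_higgs_field U \<Phi> \<longleftrightarrow>
     (\<forall>p\<in>U. \<forall>v. Vector_Spaces.linear (*s) (*s) (\<Phi> p v) \<and>
                 Vector_Spaces.linear (*s) (*s) (\<lambda>u. \<Phi> p u v)) \<and>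
     (\<forall>u v. holo_map (*s) (\<lambda>p. \<Phi> p u v) U) \<and>
     (\<forall>p\<in>U. \<forall>u v w. \<Phi> p u v = \<Phi> p v u \<and> \<Phi> p (\<Phi> p u v) w = \<Phi> p u (\<Phi> p v w))"

text \<open>
  The connection
  \<open>\<nabla> = \<pi>\<^sup>*\<nabla>\<^sup>0 + \<pi>\<^sup>*\<Phi> / z - (\<Phi>(E) / z + \<nabla>\<^sup>0 E) dz / z\<close> on \<open>\<pi>\<^sup>* TM\<close>, applied to the section \<open>Y\<close> in the direction of the
  field \<open>V\<close> with \<open>dz\<close>-component \<open>a\<close> and \<open>M\<close>-component \<open>X\<close>; here
  \<open>(\<pi>\<^sup>*\<nabla>\<^sup>0)\<^sub>V Y = a \<partial>Y/\<partial>z + \<nabla>\<^sup>0\<^sub>X Y\<close>, the last term being taken in each slice \<open>{z} \<times> M\<close>.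
\<close>

definition saito_nabla ::
  "'n conn \<Rightarrow> (complex^'n \<Rightarrow> complex^'n \<Rightarrow> complex^'n \<Rightarrow> complex^'n) \<Rightarrow> (complex^'n \<Rightarrow> complex^'n) \<Rightarrow>
   (complex \<times> (complex^'n) \<Rightarrow> complex \<times> (complex^'n)) \<Rightarrow> (complex \<times> (complex^'n) \<Rightarrow> complex^'n) \<Rightarrow>
   complex \<times> (complex^'n) \<Rightarrow> complex^'n" where
  "saito_nabla D \<Phi> E V Y = (\<lambda>(z, p).
     let a = fst (V (z, p));
         X = (\<lambda>q. snd (V (z, q)));
         Yz = (\<lambda>q. Y (z, q))
     in frechet_derivative (\<lambda>w. Y (w, p)) (at z) a + D X Yz p
        + (1 / z) *s \<Phi> p (X p) (Yz p)
        - (a / z) *s ((1 / z) *s \<Phi> p (Yz p) (E p) + D Yz E p))"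

text \<open>Integrability: the curvature vanishes off the poles \<open>z = 0, \<infinity>\<close>.\<close>

definition saito_integrable ::
  "(complex^'n) set \<Rightarrow> 'n conn \<Rightarrow> (complex^'n \<Rightarrow> complex^'n \<Rightarrow> complex^'n \<Rightarrow> complex^'n) \<Rightarrow>
   (complex^'n \<Rightarrow> complex^'n) \<Rightarrow> bool" where
  "saito_integrable U D \<Phi> E \<longleftrightarrow>
     (let S = (UNIV - {0}) \<times> U; N = saito_nabla D \<Phi> E in
      \<forall>V W Y. vector_field_prod S V \<and> vector_field_prod S W \<and> holo_map scale_prod Y S \<longrightarrow>
        (\<forall>w\<in>S. N V (N W Y) w - N W (N V Y) w - N (lie_bracket V W) Y w = 0))"

definition saito_structure ::
  "(complex^'n) set \<Rightarrow> 'n conn \<Rightarrow> (complex^'n \<Rightarrow> complex^'n \<Rightarrow> complex^'n \<Rightarrow> complex^'n) \<Rightarrow>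
   (complex^'n \<Rightarrow> complex^'n) \<Rightarrow> (complex^'n \<Rightarrow> complex^'n) \<Rightarrow> bool" where
  "saito_structure U D \<Phi> e E \<longleftrightarrow>
     holo_connection U D \<and> flat_connection U D \<and> torsion_free U D \<and>
     symmetric_higgs_field U \<Phi> \<and> vector_field U e \<and> vector_field U E \<and>
     saito_integrable U D \<Phi> E \<and>
     (\<forall>X. vector_field U X \<longrightarrow> (\<forall>p\<in>U. D X e p = 0)) \<and>
     (\<forall>p\<in>U. \<forall>v. \<Phi> p (e p) v = v)"

definition jacobian :: "('n \<Rightarrow> complex^'n \<Rightarrow> complex) \<Rightarrow> complex^'n \<Rightarrow> complex^'n^'n" where
  "jacobian t p = (\<chi> i k. frechet_derivative (t i) (at p) (axis k 1))"

text \<open>\<open>\<partial>/\<partial>t\<^sub>i = \<Sum>\<^sub>k (\<partial>x\<^sub>k/\<partial>t\<^sub>i) \<partial>/\<partial>x\<^sub>k\<close>.\<close>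

definition coordinate_field :: "('n \<Rightarrow> complex^'n \<Rightarrow> complex) \<Rightarrow> 'n \<Rightarrow> complex^'n \<Rightarrow> complex^'n" where
  "coordinate_field t i p = column i (matrix_inv (jacobian t p))"

definition flat_coordinates ::
  "(complex^'n) set \<Rightarrow> 'n conn \<Rightarrow> ('n \<Rightarrow> complex^'n \<Rightarrow> complex) \<Rightarrow> bool" where
  "flat_coordinates U D t \<longleftrightarrow>
     (\<forall>i. holo (*s) (t i) U) \<and> (\<forall>p\<in>U. det (jacobian t p) \<noteq> 0) \<and>
     (\<forall>i X. vector_field U X \<longrightarrow> (\<forall>p\<in>U. D X (coordinate_field t i) p = 0))"


section \<open>The Saito structure induced by an extended Okubo system\<close>

definition ind_phi ::
  "('n cvec \<Rightarrow> 'n cvec \<Rightarrow> 'n cmat) \<Rightarrow> 'n cvec \<Rightarrow> 'n cvec \<Rightarrow> ('n::{finite,linorder}) cvec" where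
  "ind_phi Om p v = transpose (Om p v) *v axis last_index 1"

definition ind_nabla ::
  "(('n::{finite,linorder}) cvec \<Rightarrow> 'n cvec \<Rightarrow> 'n cmat) \<Rightarrow> 'n conn" where
  "ind_nabla Om X Y p =
     inv (ind_phi Om p) (frechet_derivative (\<lambda>q. ind_phi Om q (Y q)) (at p) (X p))"

definition ind_Phi ::
  "('n cvec \<Rightarrow> 'n cvec \<Rightarrow> 'n cmat) \<Rightarrow>
   'n cvec \<Rightarrow> 'n cvec \<Rightarrow> 'n cvec \<Rightarrow> ('n::{finite,linorder}) cvec" where
  "ind_Phi Om p u v = inv (ind_phi Om p) (transpose (Om p u) *v ind_phi Om p v)"

definition ind_e ::
  "('n cvec \<Rightarrow> 'n cvec \<Rightarrow> 'n cmat) \<Rightarrow> 'n cvec \<Rightarrow> ('n::{finite,linorder}) cvec" where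
  "ind_e Om p = inv (ind_phi Om p) (axis last_index 1)"

definition ind_E ::
  "('n cvec \<Rightarrow> 'n cmat) \<Rightarrow> ('n cvec \<Rightarrow> 'n cvec \<Rightarrow> 'n cmat) \<Rightarrow>
   'n cvec \<Rightarrow> ('n::{finite,linorder}) cvec" where
  "ind_E T Om p = - inv (ind_phi Om p) (transpose (T p) *v axis last_index 1)"

text \<open>As \<open>\<phi>\<close> is holomorphic and fibrewise linear, it is a bundle isomorphism iff it is fibrewise bijective.\<close>

definition induces_saito_structure ::
  "('n::{finite,linorder}) cvec set \<Rightarrow> ('n cvec \<Rightarrow> 'n cmat) \<Rightarrow>
   ('n cvec \<Rightarrow> 'n cvec \<Rightarrow> 'n cmat) \<Rightarrow> bool" where
  "induces_saito_structure U T Om \<longleftrightarrow>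
     (\<forall>p\<in>U. bij (ind_phi Om p)) \<and>
     saito_structure U (ind_nabla Om) (ind_Phi Om) (ind_e Om) (ind_E T Om)"

end

theory Submission
  imports Defs "HOL-Complex_Analysis.Cauchy_Integral_Formula"
begin

text \<open>
  The last row of \<open>dT + \<Omega> + [\<Omega>, B\<^sub>\<infinity>] = 0\<close> reads \<open>dT\<^sub>n\<^sub>j = - (\<lambda>\<^sub>j - \<lambda>\<^sub>n + 1) \<Omega>\<^sub>n\<^sub>j\<close>, where the factor is
  nonzero by nonresonance.  Hence \<open>\<phi>\<close> is the differential of \<open>t = (t\<^sub>1,\<dots>,t\<^sub>n)\<close>, so it is bijective exactly
  where the wedge product does not vanish, and \<open>\<nabla>\<^sup>0\<close> is the trivial connection in the coordinates \<open>t\<close>.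
  Commutativity of \<open>T\<close> and of the values of \<open>\<Omega>\<close> gives the axioms of the product.  In the frame \<open>\<phi>\<close>
  the Saito connection becomes \<open>d + \<Omega>\<^sup>t/z + (T\<^sup>t/z\<^sup>2 - C/z) dz\<close> with \<open>C = B\<^sub>\<infinity> + (1 - \<lambda>\<^sub>n) I\<close>, and its
  curvature vanishes by the four equations of the Okubo system.
\<close>

section \<open>Directional derivatives of holomorphic functions\<close>

lemma holo_has_derivative:
  assumes "holo sc f S" "p \<in> S"
  shows "(f has_derivative frechet_derivative f (at p)) (at p)"
  using assms unfolding holo_def by (metis differentiableI frechet_derivative_works)

text \<open>Uniqueness of the derivative transfers the complex linearity of the witness in
  \<open>holo\<close> to \<open>frechet_derivative\<close>.\<close>

lemma holo_derivative_scale: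
  assumes "holo sc f S" "p \<in> S"
  shows "frechet_derivative f (at p) (sc c v) = c * frechet_derivative f (at p) v"
  using assms unfolding holo_def by (metis frechet_derivative_at)

lemma holoI:
  assumes "\<And>p. p \<in> S \<Longrightarrow> (f has_derivative f' p) (at p)"
    and "\<And>p c v. p \<in> S \<Longrightarrow> f' p (sc c v) = c * f' p v"
  shows "holo sc f S"
  using assms unfolding holo_def by blast

lemma holo_continuous_on: "holo sc f S \<Longrightarrow> continuous_on S f"
  by (intro continuous_at_imp_continuous_on ballI has_derivative_continuous[OF holo_has_derivative])

lemma holo_cong:
  assumes "open S" "\<And>p. p \<in> S \<Longrightarrow> f p = g p" "holo sc f S"
  shows "holo sc g S"
  unfolding holo_def
proof
  fix p assume p: "p \<in> S"
  then obtain f' where "(f has_derivative f') (at p)" and f': "\<forall>c v. f' (sc c v) = c * f' v"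
    using assms(3) unfolding holo_def by blast
  then have "(g has_derivative f') (at p)"
    using has_derivative_transform_within_open[OF _ assms(1) p] assms(2) by blast
  then show "\<exists>f'. (g has_derivative f') (at p) \<and> (\<forall>c v. f' (sc c v) = c * f' v)"
    using f' by blast
qed

lemma holo_const [simp]: "holo sc (\<lambda>_. a) S"
  by (rule holoI[where f' = "\<lambda>_ _. 0"]) auto

lemma holo_add: "holo sc f S \<Longrightarrow> holo sc g S \<Longrightarrow> holo sc (\<lambda>p. f p + g p) S"
  by (rule holoI[OF has_derivative_add[OF holo_has_derivative holo_has_derivative]])
    (auto simp: holo_derivative_scale algebra_simps)

lemma holo_mult: "holo sc f S \<Longrightarrow> holo sc g S \<Longrightarrow> holo sc (\<lambda>p. f p * g p) S"
  by (rule holoI[OF has_derivative_mult[OF holo_has_derivative holo_has_derivative]])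
    (auto simp: holo_derivative_scale algebra_simps)

lemma holo_minus: "holo sc f S \<Longrightarrow> holo sc (\<lambda>p. - f p) S"
  using holo_mult[OF holo_const[of sc "-1" S]] by simp

lemma holo_inverse:
  assumes "holo sc f S" "\<And>p. p \<in> S \<Longrightarrow> f p \<noteq> 0"
  shows "holo sc (\<lambda>p. inverse (f p)) S"
  by (rule holoI[OF Deriv.has_derivative_inverse[OF _ holo_has_derivative[OF assms(1)]]])
    (auto simp: assms holo_derivative_scale[OF assms(1)] algebra_simps)

lemma holo_sum: "(\<And>i. i \<in> I \<Longrightarrow> holo sc (f i) S) \<Longrightarrow> holo sc (\<lambda>p. \<Sum>i\<in>I. f i p) S"
  by (induction I rule: infinite_finite_induct) (auto intro: holo_add)

lemma holo_prod: "(\<And>i. i \<in> I \<Longrightarrow> holo sc (f i) S) \<Longrightarrow> holo sc (\<lambda>p. \<Prod>i\<in>I. f i p) S"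
  by (induction I rule: infinite_finite_induct) (auto intro: holo_mult)

lemma holo_det: "(\<And>i j. holo sc (\<lambda>p. A p $ i $ j) S) \<Longrightarrow> holo sc (\<lambda>p. det (A p)) S"
  unfolding det_def by (intro holo_sum holo_mult holo_prod) auto

text \<open>Cauchy's formula on the complex line through \<open>p\<close> in the direction \<open>v\<close>.\<close>

lemma directional_derivative_integral:
  fixes f :: "'a::euclidean_space \<Rightarrow> complex"
  assumes sc: "bounded_bilinear sc" and f: "holo sc f S" and S: "open S" and r: "0 < r"
    and cb: "\<And>\<zeta>. \<zeta> \<in> cball 0 r \<Longrightarrow> p + sc \<zeta> v \<in> S"
  shows "frechet_derivative f (at p) v =
    integral {0..1} (\<lambda>t. cis (- 2 * pi * t) / r * f (p + sc (r * cis (2 * pi * t)) v))"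
proof -
  interpret bounded_bilinear sc by fact
  define g where "g = (\<lambda>\<zeta>. f (p + sc \<zeta> v))"
  have gd: "(g has_field_derivative frechet_derivative f (at (p + sc \<zeta> v)) v) (at \<zeta>)"
    if "p + sc \<zeta> v \<in> S" for \<zeta>
  proof -
    have "((\<lambda>\<zeta>. p + sc \<zeta> v) has_derivative (\<lambda>h. sc h v)) (at \<zeta>)"
      by (auto intro!: derivative_eq_intros bounded_linear.has_derivative[OF bounded_linear_left])
    from has_derivative_compose[OF this holo_has_derivative[OF f that]]
    show ?thesis
      unfolding g_def has_field_derivative_def
      by (rule has_derivative_eq_rhs) (auto simp: holo_derivative_scale[OF f that] mult.commute)
  qed
  have gfd: "g field_differentiable at \<zeta>" if "\<zeta> \<in> cball 0 r" for \<zeta>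
    using gd[OF cb[OF that]] unfolding field_differentiable_def by blast
  have hol: "g holomorphic_on ball 0 r"
    using field_differentiable_at_within[OF gfd] by (auto intro!: holomorphic_onI)
  have cont: "continuous_on (cball 0 r) g"
    using gfd by (intro continuous_at_imp_continuous_on ballI field_differentiable_imp_continuous_at)
  have "p \<in> S" using cb[of 0] r by (simp add: zero_left)
  then have "deriv g 0 = frechet_derivative f (at p) v"
    using DERIV_imp_deriv[OF gd[of 0]] by (simp add: zero_left)
  moreover have "contour_integral (circlepath 0 r) (\<lambda>u. g u / (u - 0)^2) = (2 * pi * \<i>) * deriv g 0"
    by (rule Cauchy_contour_integral_circlepath_2[OF cont hol]) (use r in auto)
  ultimately have "frechet_derivative f (at p) v
      = contour_integral (circlepath 0 r) (\<lambda>u. g u / u^2) / (2 * pi * \<i>)"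
    by simp
  also have "\<dots> = integral {0..1} (\<lambda>t. g (circlepath 0 r t) / (circlepath 0 r t)^2 *
                 vector_derivative (circlepath 0 r) (at t) / (2 * pi * \<i>))"
    unfolding contour_integral_integral integral_divide ..
  \<comment> \<open>With \<open>u = r * cis (2 * pi * t)\<close> one has
    \<open>du = 2 * pi * \<i> * u dt\<close>, so \<open>g u / u^2 du\<close> divided by
    \<open>2 * pi * \<i>\<close> becomes \<open>g u / u dt\<close>, and
    \<open>1 / u = cis (- 2 * pi * t) / r\<close>.\<close>
  also have "\<dots> = integral {0..1} (\<lambda>t. cis (- 2 * pi * t) / r * g (r * cis (2 * pi * t)))"
  proof (rule integral_cong)
    fix t :: real
    define c where "c = exp (2 * of_real pi * \<i> * of_real t)"
    have c: "c \<noteq> 0" "cis (2 * pi * t) = c" "cis (- 2 * pi * t) = inverse c"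
      by (auto simp: c_def cis_conv_exp mult_ac exp_minus)
    have cp: "circlepath 0 r t = r * c"
      by (simp add: circlepath c_def)
    have vd: "vector_derivative (circlepath 0 r) (at t) = 2 * pi * \<i> * r * c"
      by (simp add: vector_derivative_circlepath c_def)
    show "g (circlepath 0 r t) / (circlepath 0 r t)^2 *
            vector_derivative (circlepath 0 r) (at t) / (2 * pi * \<i>) =
          cis (- 2 * pi * t) / r * g (r * cis (2 * pi * t))"
      unfolding c(2,3) cp vd using r c(1) by (simp add: field_simps power2_eq_square)
  qed
  finally show ?thesis unfolding g_def .
qed

text \<open>
  Cauchy's formula may be differentiated under the integral sign; applying it to a function and to its
  directional derivative gives the symmetry of the second derivative.
\<close>

lemma ex_complex_discs_subset:
  fixes p :: "'a::real_normed_vector"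
  assumes "bounded_bilinear sc" "open S" "p \<in> S"
  obtains r d :: real where "0 < r" "0 < d"
    "\<And>q \<zeta>. q \<in> ball p d \<Longrightarrow> \<zeta> \<in> cball 0 r \<Longrightarrow> q + sc \<zeta> v \<in> S"
proof -
  obtain K where K: "0 < K" "\<And>a b. norm (sc a b) \<le> norm a * norm b * K"
    using bounded_bilinear.pos_bounded[OF assms(1)] by blast
  obtain e where e: "0 < e" "ball p e \<subseteq> S"
    using assms(2,3) openE by blast
  \<comment> \<open>The summand 1 keeps \<open>N\<close> positive when \<open>v = 0\<close>. The
    radius \<open>e / 2 / N\<close> spends half of \<open>e\<close> on the disc and leaves the other
    half for moving its centre.\<close>
  define N where "N = norm v * K + 1"
  define r where "r = e / 2 / N"
  have pos: "0 < N"
    using K(1) by (simp add: N_def add_nonneg_pos)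
  have "q + sc \<zeta> v \<in> S" if "q \<in> ball p (e / 2)" "\<zeta> \<in> cball 0 r" for q \<zeta>
  proof -
    have "norm (sc \<zeta> v) \<le> norm \<zeta> * (norm v * K)"
      using K(2)[of \<zeta> v] by (simp add: mult_ac)
    also have "\<dots> \<le> r * (norm v * K)"
      using that(2) K(1) by (intro mult_right_mono) auto
    also have "\<dots> \<le> r * N"
      using e(1) pos by (intro mult_left_mono) (auto simp: r_def N_def)
    also have "\<dots> = e / 2"
      using pos by (simp add: r_def)
    finally have "norm (sc \<zeta> v) \<le> e / 2" .
    moreover have "dist p (q + sc \<zeta> v) \<le> dist p q + norm (sc \<zeta> v)"
      using dist_triangle[of p "q + sc \<zeta> v" q] by (simp add: dist_norm)
    ultimately have "q + sc \<zeta> v \<in> ball p e"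
      using that(1) by simp
    then show ?thesis using e(2) by blast
  qed
  then show ?thesis using that[of r "e / 2"] e(1) pos by (simp add: r_def)
qed

text \<open>Joint continuity in the centre and the angle is what theorems on parameter integrals ask
  for. The function \<open>g\<close> stays arbitrary because it will be \<open>f\<close> as well as
  a directional derivative of \<open>f\<close>.\<close>

lemma cauchy_kernel_param_continuous:
  fixes g :: "'a::real_normed_vector \<Rightarrow> complex"
  assumes sc: "bounded_bilinear sc" and g: "continuous_on S g" and r: "0 < r"
    and cb: "\<And>q \<zeta>. q \<in> B \<Longrightarrow> \<zeta> \<in> cball 0 r \<Longrightarrow> q + sc \<zeta> v \<in> S"
  shows "continuous_on (B \<times> A) (\<lambda>(q, t). cis (- 2 * pi * t) / r * g (q + sc (r * cis (2 * pi * t)) v))"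
proof -
  have "continuous_on (B \<times> A) (\<lambda>x. fst x + sc (of_real r * cis (2 * pi * snd x)) v)"
    by (intro continuous_intros bounded_linear.continuous_on[OF bounded_bilinear.bounded_linear_left[OF sc]])
  moreover have "(\<lambda>x. fst x + sc (of_real r * cis (2 * pi * snd x)) v) ` (B \<times> A) \<subseteq> S"
    using cb r by (auto simp: norm_mult)
  ultimately have "continuous_on (B \<times> A) (\<lambda>x. g (fst x + sc (of_real r * cis (2 * pi * snd x)) v))"
    by (rule continuous_on_compose2[OF g])
  then show ?thesis
    unfolding split_beta using r by (intro continuous_intros) auto
qed

text \<open>One radius serves all centres near \<open>p\<close>, so the derivative is locally a
  parameter integral with jointly continuous integrand. This continuity, which \<open>holo\<close>
  does not postulate, feeds the Leibniz rule.\<close>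

lemma holo_derivative_continuous_on:
  fixes f :: "'a::euclidean_space \<Rightarrow> complex"
  assumes sc: "bounded_bilinear sc" and f: "holo sc f S" and S: "open S"
  shows "continuous_on S (\<lambda>p. frechet_derivative f (at p) v)"
proof (intro continuous_at_imp_continuous_on ballI)
  fix p assume "p \<in> S"
  then obtain r d where rd: "0 < r" "0 < d"
    and cb: "\<And>q \<zeta>. q \<in> ball p d \<Longrightarrow> \<zeta> \<in> cball 0 r \<Longrightarrow> q + sc \<zeta> v \<in> S"
    using ex_complex_discs_subset[OF sc S] by blast
  have "continuous_on (ball p d)
      (\<lambda>q. integral (cbox 0 1) (\<lambda>t. cis (- 2 * pi * t) / r * f (q + sc (r * cis (2 * pi * t)) v)))"
    by (rule integral_continuous_on_param
        [OF cauchy_kernel_param_continuous[OF sc holo_continuous_on[OF f] rd(1) cb]])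
  also have "?this \<longleftrightarrow> continuous_on (ball p d) (\<lambda>q. frechet_derivative f (at q) v)"
    by (rule continuous_on_cong[OF refl], unfold box_real)
      (rule directional_derivative_integral[OF sc f S rd(1) cb, symmetric])
  finally show "isCont (\<lambda>q. frechet_derivative f (at q) v) p"
    using rd(2) by (simp add: continuous_on_eq_continuous_at)
qed

text \<open>In the Cauchy integrand only the factor \<open>f\<close> depends on the centre, so the
  Leibniz rule replaces it by its derivative in the direction \<open>h\<close>.\<close>

lemma has_derivative_holo_derivative:
  fixes f :: "'a::euclidean_space \<Rightarrow> complex"
  assumes sc: "bounded_bilinear sc" and f: "holo sc f S" and S: "open S" and r: "0 < r" "0 < d"
    and cb: "\<And>q \<zeta>. q \<in> ball p d \<Longrightarrow> \<zeta> \<in> cball 0 r \<Longrightarrow> q + sc \<zeta> v \<in> S"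
  shows "((\<lambda>q. frechet_derivative f (at q) v) has_derivative
    (\<lambda>h. integral {0..1} (\<lambda>t. cis (- 2 * pi * t) / r *
            frechet_derivative f (at (p + sc (r * cis (2 * pi * t)) v)) h))) (at p)"
proof -
  let ?k = "\<lambda>t. cis (- 2 * pi * t) / of_real r" and ?c = "\<lambda>q t. q + sc (of_real r * cis (2 * pi * t)) v"
  \<comment> \<open>The Leibniz rule takes the derivative of the integrand as a bounded linear map.
    The value of \<open>Blinfun\<close> is meaningful for centres in the ball, where
    \<open>der\<close> supplies boundedness and linearity.\<close>
  define G where "G = (\<lambda>q t. Blinfun (\<lambda>h. ?k t * frechet_derivative f (at (?c q t)) h))"
  have cS: "?c q t \<in> S" if "q \<in> ball p d" for q t
    using cb[OF that] r(1) by (simp add: norm_mult)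
  have der: "((\<lambda>q. ?k t * f (?c q t)) has_derivative
      (\<lambda>h. ?k t * frechet_derivative f (at (?c q t)) h)) (at q)" if "q \<in> ball p d" for q t
  proof -
    have "((\<lambda>q. ?c q t) has_derivative (\<lambda>h. h)) (at q)"
      by (auto intro!: derivative_eq_intros)
    from has_derivative_compose[OF this holo_has_derivative[OF f cS[OF that]]]
    show ?thesis by (rule has_derivative_mult_right)
  qed
  have G: "blinfun_apply (G q t) = (\<lambda>h. ?k t * frechet_derivative f (at (?c q t)) h)"
    if "q \<in> ball p d" for q t
    unfolding G_def by (rule bounded_linear_Blinfun_apply[OF has_derivative_bounded_linear[OF der[OF that]]])
  \<comment> \<open>In finite dimension, continuity in operator norm can be tested on basis
    vectors.\<close>
  have contG: "continuous_on (ball p d \<times> A) (\<lambda>(q, t). G q t)" for A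
  proof (rule continuous_on_blinfun_componentwise)
    fix i :: 'a
    have "continuous_on (ball p d \<times> A) (\<lambda>(q, t). ?k t * frechet_derivative f (at (?c q t)) i)"
      by (rule cauchy_kernel_param_continuous[OF sc holo_derivative_continuous_on[OF sc f S] r(1) cb])
    then show "continuous_on (ball p d \<times> A) (\<lambda>x. blinfun_apply (case x of (q, t) \<Rightarrow> G q t) i)"
      by (rule continuous_on_eq) (auto simp: G)
  qed
  have contG1: "continuous_on A (G p)" for A
  proof -
    have "Pair p ` A \<subseteq> ball p d \<times> A"
      using r(2) by auto
    from continuous_on_compose2[OF contG _ this] show ?thesis
      by (simp add: continuous_on_Pair)
  qed
  have contf: "continuous_on A (\<lambda>t. ?k t * f (?c q t))" if "q \<in> ball p d" for q A
  proof -
    have "Pair q ` A \<subseteq> ball p d \<times> A"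
      using that by auto
    from continuous_on_compose2[OF cauchy_kernel_param_continuous
        [OF sc holo_continuous_on[OF f] r(1) cb] _ this]
    show ?thesis by (simp add: continuous_on_Pair)
  qed
  have "((\<lambda>q. integral (cbox 0 1) (\<lambda>t. ?k t * f (?c q t))) has_derivative integral (cbox 0 1) (G p))
      (at p within ball p d)"
  proof (rule leibniz_rule)
    show "((\<lambda>q. ?k t * f (?c q t)) has_derivative blinfun_apply (G q t)) (at q within ball p d)"
      if "q \<in> ball p d" for q t
      unfolding G[OF that] by (rule has_derivative_at_withinI[OF der[OF that]])
    show "(\<lambda>t. ?k t * f (?c q t)) integrable_on cbox 0 1" if "q \<in> ball p d" for q
      unfolding box_real by (rule integrable_continuous_interval[OF contf[OF that]])
    show "p \<in> ball p d" using r(2) by simp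
  qed (rule contG convex_ball)+
  moreover have "at p within ball p d = at p"
    using r(2) by (intro at_within_open) auto
  ultimately have "((\<lambda>q. integral {0..1} (\<lambda>t. ?k t * f (?c q t))) has_derivative integral {0..1} (G p)) (at p)"
    by (simp only: box_real)
  then have "((\<lambda>q. frechet_derivative f (at q) v) has_derivative integral {0..1} (G p)) (at p)"
  proof (rule has_derivative_transform_within_open)
    show "open (ball p d)" "p \<in> ball p d" using r(2) by auto
    show "integral {0..1} (\<lambda>t. ?k t * f (?c q t)) = frechet_derivative f (at q) v"
      if "q \<in> ball p d" for q
      by (rule directional_derivative_integral[OF sc f S r(1) cb[OF that], symmetric])
  qed
  \<comment> \<open>Evaluation at \<open>h\<close> is bounded linear and passes through the
    integral.\<close>
  moreover have "blinfun_apply (integral {0..1} (G p)) h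
      = integral {0..1} (\<lambda>t. ?k t * frechet_derivative f (at (?c p t)) h)" for h
    using integral_linear[OF integrable_continuous_interval[OF contG1] blinfun.bounded_linear_left, of 0 1 h]
    unfolding o_def G[of p, unfolded mem_ball dist_self, OF r(2)] by (rule sym)
  ultimately show ?thesis
    by (rule has_derivative_eq_rhs[OF _ ext])
qed

text \<open>The integral formula for the second derivative is complex linear in its direction
  because the integrand is. Directional derivatives can therefore be iterated within
  \<open>holo\<close>.\<close>

lemma holo_derivative:
  fixes f :: "'a::euclidean_space \<Rightarrow> complex"
  assumes sc: "bounded_bilinear sc" and f: "holo sc f S" and S: "open S"
  shows "holo sc (\<lambda>p. frechet_derivative f (at p) v) S"
  unfolding holo_def
proof
  fix p assume "p \<in> S"
  then obtain r d where rd: "0 < r" "0 < d"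
    and cb: "\<And>q \<zeta>. q \<in> ball p d \<Longrightarrow> \<zeta> \<in> cball 0 r \<Longrightarrow> q + sc \<zeta> v \<in> S"
    using ex_complex_discs_subset[OF sc S] by blast
  have cS: "p + sc (of_real r * cis (2 * pi * t)) v \<in> S" for t
    using cb[of p] rd by (simp add: norm_mult)
  show "\<exists>f'. ((\<lambda>p. frechet_derivative f (at p) v) has_derivative f') (at p) \<and> (\<forall>c w. f' (sc c w) = c * f' w)"
    by (intro exI conjI, rule has_derivative_holo_derivative[OF sc f S rd cb])
      (simp_all add: holo_derivative_scale[OF f cS] mult.left_commute)
qed

lemma holo_derivative_commute:
  fixes f :: "'a::euclidean_space \<Rightarrow> complex"
  assumes sc: "bounded_bilinear sc" and f: "holo sc f S" and S: "open S" and p: "p \<in> S"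
  shows "frechet_derivative (\<lambda>q. frechet_derivative f (at q) v) (at p) u =
    frechet_derivative (\<lambda>q. frechet_derivative f (at q) u) (at p) v"
proof -
  obtain r d where rd: "0 < r" "0 < d"
    and cb: "\<And>q \<zeta>. q \<in> ball p d \<Longrightarrow> \<zeta> \<in> cball 0 r \<Longrightarrow> q + sc \<zeta> v \<in> S"
    using ex_complex_discs_subset[OF sc S p] by blast
  let ?I = "\<lambda>h. integral {0..1} (\<lambda>t. cis (- 2 * pi * t) / r *
        frechet_derivative f (at (p + sc (r * cis (2 * pi * t)) v)) h)"
  have "((\<lambda>q. frechet_derivative f (at q) v) has_derivative ?I) (at p)"
    by (rule has_derivative_holo_derivative[OF sc f S rd cb])
  from fun_cong[OF frechet_derivative_at[OF this], of u]
  have "frechet_derivative (\<lambda>q. frechet_derivative f (at q) v) (at p) u = ?I u"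
    by (rule sym)
  moreover have "p \<in> ball p d"
    using rd(2) by simp
  \<comment> \<open>In the other order, Cauchy's formula in the direction \<open>v\<close> is
    applied to the holomorphic function \<open>frechet_derivative f (at q) u\<close>; on the same
    circle it produces the same integral.\<close>
  then have "frechet_derivative (\<lambda>q. frechet_derivative f (at q) u) (at p) v = ?I u"
    by (intro directional_derivative_integral[OF sc holo_derivative[OF sc f S] S rd(1)] cb)
  ultimately show ?thesis by simp
qed

section \<open>Vector-valued maps and derivatives along vector fields\<close>

lemma bounded_bilinear_vector_scalar_mult:
  "bounded_bilinear ((*s) :: complex \<Rightarrow> complex^'n \<Rightarrow> complex^'n)"
  unfolding bilinear_conv_bounded_bilinear[symmetric] bilinear_def
  by (auto intro!: linearI simp: vec_eq_iff algebra_simps)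

lemma bounded_bilinear_scale_prod:
  "bounded_bilinear (scale_prod :: complex \<Rightarrow> complex \<times> (complex^'n) \<Rightarrow> _)"
  unfolding bilinear_conv_bounded_bilinear[symmetric] bilinear_def scale_prod_def
  by (auto intro!: linearI simp: vec_eq_iff algebra_simps)

lemma bounded_bilinear_matrix_vector_mult:
  "bounded_bilinear ((*v) :: complex^'n^'m \<Rightarrow> complex^'n \<Rightarrow> complex^'m)"
  unfolding bilinear_conv_bounded_bilinear[symmetric] bilinear_def
  by (auto intro!: linearI simp: vec_eq_iff matrix_vector_mult_def algebra_simps sum.distrib
      scaleR_sum_right)

lemma has_derivative_vec_iff:
  fixes F :: "'a::real_normed_vector \<Rightarrow> 'b::euclidean_space^'m"
  shows "(F has_derivative F') (at p) \<longleftrightarrow> (\<forall>i. ((\<lambda>q. F q $ i) has_derivative (\<lambda>v. F' v $ i)) (at p))"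
proof
  assume "\<forall>i. ((\<lambda>q. F q $ i) has_derivative (\<lambda>v. F' v $ i)) (at p)"
  then show "(F has_derivative F') (at p)"
    by (subst has_derivative_componentwise_within)
      (auto simp: Basis_vec_def inner_axis intro: has_derivative_inner_left)
qed (auto intro: bounded_linear.has_derivative[OF bounded_linear_vec_nth])

lemma frechet_derivative_vec_nth:
  fixes F :: "'a::real_normed_vector \<Rightarrow> 'b::euclidean_space^'m"
  assumes "F differentiable at p"
  shows "frechet_derivative (\<lambda>q. F q $ i) (at p) v = frechet_derivative F (at p) v $ i"
  using assms has_derivative_vec_iff[of F _ p] frechet_derivative_at[of "\<lambda>q. F q $ i"]
  by (metis frechet_derivative_works)

lemma holo_map_differentiable: "holo_map sc F S \<Longrightarrow> p \<in> S \<Longrightarrow> F differentiable at p"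
  unfolding differentiable_def holo_map_def
  using holo_has_derivative[of sc _ S p] has_derivative_vec_iff
    [of F "\<lambda>v. \<chi> i. frechet_derivative (\<lambda>q. F q $ i) (at p) v" p] by auto

lemma holo_map_has_derivative:
  "holo_map sc F S \<Longrightarrow> p \<in> S \<Longrightarrow> (F has_derivative frechet_derivative F (at p)) (at p)"
  using holo_map_differentiable frechet_derivative_works by blast

lemma holo_map_derivative_nth:
  "holo_map sc F S \<Longrightarrow> p \<in> S \<Longrightarrow>
    frechet_derivative F (at p) v $ i = frechet_derivative (\<lambda>q. F q $ i) (at p) v"
  by (metis frechet_derivative_vec_nth holo_map_differentiable)

lemma holo_map_derivative_scale:
  "holo_map sc F S \<Longrightarrow> p \<in> S \<Longrightarrow>
    frechet_derivative F (at p) (sc c v) = c *s frechet_derivative F (at p) v"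
  by (auto simp: vec_eq_iff holo_map_derivative_nth holo_map_def intro: holo_derivative_scale)

lemma holo_map_cong:
  "open S \<Longrightarrow> (\<And>p. p \<in> S \<Longrightarrow> F p = G p) \<Longrightarrow> holo_map sc F S \<Longrightarrow> holo_map sc G S"
  unfolding holo_map_def using holo_cong[of S "\<lambda>p. F p $ i" "\<lambda>p. G p $ i" sc for i] by auto

lemma holo_map_derivative:
  fixes F :: "'a::euclidean_space \<Rightarrow> complex^'m"
  assumes "bounded_bilinear sc" "holo_map sc F S" "open S"
  shows "holo_map sc (\<lambda>p. frechet_derivative F (at p) v) S"
  using holo_cong[OF assms(3) holo_map_derivative_nth[OF assms(2), symmetric] holo_derivative[OF assms(1) _ assms(3)]]
    assms(2) unfolding holo_map_def by blast

lemma holo_map_derivative_commute: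
  fixes F :: "'a::euclidean_space \<Rightarrow> complex^'m"
  assumes sc: "bounded_bilinear sc" and F: "holo_map sc F S" and S: "open S" and p: "p \<in> S"
  shows "frechet_derivative (\<lambda>q. frechet_derivative F (at q) v) (at p) u =
    frechet_derivative (\<lambda>q. frechet_derivative F (at q) u) (at p) v"
proof -
  have "frechet_derivative (\<lambda>q. frechet_derivative F (at q) v) (at p) u $ i =
      frechet_derivative (\<lambda>q. frechet_derivative (\<lambda>q. F q $ i) (at q) v) (at p) u" for i u v
  proof -
    have "((\<lambda>q. frechet_derivative F (at q) v $ i) has_derivative
        (\<lambda>u. frechet_derivative (\<lambda>q. frechet_derivative F (at q) v) (at p) u $ i)) (at p)"
      using holo_map_has_derivative[OF holo_map_derivative[OF sc F S] p]
      by (rule bounded_linear.has_derivative[OF bounded_linear_vec_nth])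
    then have "((\<lambda>q. frechet_derivative (\<lambda>q. F q $ i) (at q) v) has_derivative
        (\<lambda>u. frechet_derivative (\<lambda>q. frechet_derivative F (at q) v) (at p) u $ i)) (at p)"
      by (rule has_derivative_transform_within_open[OF _ S p]) (rule holo_map_derivative_nth[OF F])
    from fun_cong[OF frechet_derivative_at[OF this], of u] show ?thesis .
  qed
  then show ?thesis
    using holo_derivative_commute[OF sc _ S p] F by (simp add: vec_eq_iff holo_map_def)
qed

text \<open>Product rule for \<open>dF(X)\<close>: the point enters through the base point of
  \<open>dF\<close> and through the argument \<open>X\<close>.\<close>

lemma has_derivative_derivative_along:
  fixes F :: "'a::euclidean_space \<Rightarrow> complex^'m"
  assumes sc: "bounded_bilinear sc" and F: "holo_map sc F S" and S: "open S" and p: "p \<in> S"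
    and X: "(X has_derivative X') (at p)"
  shows "((\<lambda>q. frechet_derivative F (at q) (X q)) has_derivative
    (\<lambda>h. frechet_derivative (\<lambda>q. frechet_derivative F (at q) (X p)) (at p) h
        + frechet_derivative F (at p) (X' h))) (at p)"
proof -
  note dF = holo_map_derivative[OF sc F S]
  \<comment> \<open>Expanding the direction in a fixed real basis turns \<open>dF(X)\<close> into a
    finite sum of products, each factor of which is differentiable.\<close>
  have expand: "frechet_derivative F (at q) w = (\<Sum>b\<in>Basis. (w \<bullet> b) *\<^sub>R frechet_derivative F (at q) b)"
    if "q \<in> S" for q w
  proof -
    interpret bounded_linear "frechet_derivative F (at q)"
      by (rule has_derivative_bounded_linear[OF holo_map_has_derivative[OF F that]])
    show ?thesis
      by (subst euclidean_representation[of w, symmetric]) (simp only: sum scaleR)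
  qed
  have sum_deriv: "((\<lambda>q. \<Sum>b\<in>Basis. (W q \<bullet> b) *\<^sub>R frechet_derivative F (at q) b) has_derivative
      (\<lambda>h. \<Sum>b\<in>Basis. (W p \<bullet> b) *\<^sub>R frechet_derivative (\<lambda>q. frechet_derivative F (at q) b) (at p) h
          + (W' h \<bullet> b) *\<^sub>R frechet_derivative F (at p) b)) (at p)"
    if "(W has_derivative W') (at p)" for W W'
    by (intro has_derivative_sum has_derivative_scaleR has_derivative_inner_left that
        holo_map_has_derivative[OF dF p])
  have along: "((\<lambda>q. frechet_derivative F (at q) (W q)) has_derivative
      (\<lambda>h. \<Sum>b\<in>Basis. (W p \<bullet> b) *\<^sub>R frechet_derivative (\<lambda>q. frechet_derivative F (at q) b) (at p) h
          + (W' h \<bullet> b) *\<^sub>R frechet_derivative F (at p) b)) (at p)"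
    if "(W has_derivative W') (at p)" for W W'
    by (rule has_derivative_transform_within_open[OF sum_deriv[OF that] S p]) (rule expand[symmetric])
  \<comment> \<open>For a constant field the second summand vanishes; this identifies the first sum
    as a single second derivative.\<close>
  have const: "frechet_derivative (\<lambda>q. frechet_derivative F (at q) (X p)) (at p) h =
      (\<Sum>b\<in>Basis. (X p \<bullet> b) *\<^sub>R frechet_derivative (\<lambda>q. frechet_derivative F (at q) b) (at p) h)" for h
    using fun_cong[OF frechet_derivative_at[OF along[OF has_derivative_const]], of "X p" h] by simp
  show ?thesis
    by (rule has_derivative_eq_rhs[OF along[OF X]])
      (simp add: const expand[OF p, symmetric] sum.distrib)
qed

text \<open>The second derivatives of \<open>F\<close> cancel by symmetry and only the derivatives
  of the fields survive. Torsion-freeness, flatness and integrability all rest on this identity, for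
  different choices of \<open>F\<close>.\<close>

lemma derivative_along_commutator:
  fixes F :: "'a::euclidean_space \<Rightarrow> complex^'m"
  assumes sc: "bounded_bilinear sc" and F: "holo_map sc F S" and S: "open S" and p: "p \<in> S"
    and X: "X differentiable at p" and Y: "Y differentiable at p"
  shows "frechet_derivative (\<lambda>q. frechet_derivative F (at q) (Y q)) (at p) (X p)
      - frechet_derivative (\<lambda>q. frechet_derivative F (at q) (X q)) (at p) (Y p)
    = frechet_derivative F (at p) (lie_bracket X Y p)"
proof -
  note along = frechet_derivative_at[OF has_derivative_derivative_along[OF sc F S p], symmetric]
  interpret dF: bounded_linear "frechet_derivative F (at p)"
    by (rule has_derivative_bounded_linear[OF holo_map_has_derivative[OF F p]])
  show ?thesis
    using holo_map_derivative_commute[OF sc F S p, of "Y p" "X p"]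
    by (simp add: along[OF X[unfolded frechet_derivative_works]] along[OF Y[unfolded frechet_derivative_works]]
        lie_bracket_def dF.diff)
qed

lemma vec_eq_sum_axis: "v = (\<Sum>k\<in>UNIV. v $ k *s axis k (1::complex))"
  by (simp add: basis_expansion)

lemma holo_map_derivative_along:
  fixes F :: "complex^'n \<Rightarrow> complex^'m"
  assumes F: "holo_map (*s) F U" and X: "holo_map (*s) X U" and U: "open U"
  shows "holo_map (*s) (\<lambda>p. frechet_derivative F (at p) (X p)) U"
proof (rule holo_map_cong[OF U])
  fix p assume p: "p \<in> U"
  interpret dF: bounded_linear "frechet_derivative F (at p)"
    by (rule has_derivative_bounded_linear[OF holo_map_has_derivative[OF F p]])
  show "(\<Sum>k\<in>UNIV. X p $ k *s frechet_derivative F (at p) (axis k 1)) = frechet_derivative F (at p) (X p)"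
    by (subst (2) vec_eq_sum_axis) (simp only: dF.sum holo_map_derivative_scale[OF F p])
next
  show "holo_map (*s) (\<lambda>p. \<Sum>k\<in>UNIV. X p $ k *s frechet_derivative F (at p) (axis k 1)) U"
    using holo_map_derivative[OF bounded_bilinear_vector_scalar_mult F U] X
    by (auto simp: holo_map_def intro!: holo_sum holo_mult)
qed

section \<open>The equations of an Okubo system\<close>

text \<open>\<open>frechet_derivative\<close> is a choice among all derivatives; functions that
  agree near \<open>p\<close> have the same candidates, hence the same choice, even without
  differentiability.\<close>

lemma frechet_derivative_cong_open:
  assumes "open S" "p \<in> S" "\<And>q. q \<in> S \<Longrightarrow> f q = g q"
  shows "frechet_derivative f (at p) = frechet_derivative g (at p)"
proof -
  have "(f has_derivative f') (at p) \<longleftrightarrow> (g has_derivative f') (at p)" for f'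
    using has_derivative_transform_within_open[OF _ assms(1,2)] assms(3) by metis
  then show ?thesis unfolding frechet_derivative_def by simp
qed

section \<open>Diagonal matrices, determinants and Cramer's rule\<close>

lemma diag_mult_nth:
  "(diag d ** A) $ i $ j = d i * A $ i $ j" "(A ** diag d) $ i $ j = A $ i $ j * d j"
  unfolding matrix_matrix_mult_def diag_def
  by (auto simp: if_distrib if_distribR cong: if_cong)

lemma diag_mult_vec_nth: "(diag d *v x) $ i = d i * x $ i"
  unfolding matrix_vector_mult_def diag_def by (auto simp: if_distrib if_distribR cong: if_cong)

lemma matrix_vector_mult_axis: "((A :: complex^'n^'m) *v axis k 1) $ i = A $ i $ k"
  unfolding matrix_vector_mult_def axis_def by (auto simp: if_distrib cong: if_cong)

lemma det_diag: "det (diag d) = (\<Prod>i\<in>UNIV. d i)"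
  by (subst det_diagonal) (auto simp: diag_def)

lemma matrix_mult_matrix_inv: "invertible A \<Longrightarrow> A ** matrix_inv A = mat 1"
  unfolding invertible_def matrix_inv_def by (rule someI2_ex) auto

lemma wedge_UNIV: "wedge UNIV \<alpha> v = det (\<chi> i j. \<alpha> i (v j))"
  by (simp add: wedge_def det_def)

text \<open>By Cramer's rule the components of the solution are quotients of determinants with
  holomorphic entries. It serves to show that the inverse of \<open>\<phi>\<close> preserves
  holomorphy.\<close>

lemma holo_map_linear_preimage:
  fixes A :: "'a::real_normed_vector \<Rightarrow> complex^'n^'n"
  assumes S: "open S" and A: "\<And>i j. holo sc (\<lambda>p. A p $ i $ j) S" and det: "\<And>p. p \<in> S \<Longrightarrow> det (A p) \<noteq> 0"
    and W: "holo_map sc W S" and V: "\<And>p. p \<in> S \<Longrightarrow> A p *v V p = W p"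
  shows "holo_map sc V S"
  unfolding holo_map_def
proof
  fix k
  let ?B = "\<lambda>p. \<chi> i j. if j = k then W p $ i else A p $ i $ j"
  have "holo sc (\<lambda>p. det (?B p) * inverse (det (A p))) S"
  proof (intro holo_mult holo_inverse holo_det)
    show "holo sc (\<lambda>p. ?B p $ i $ j) S" for i j
      using W A by (cases "j = k") (auto simp: holo_map_def)
  qed (use A det in auto)
  then show "holo sc (\<lambda>p. V p $ k) S"
  proof (rule holo_cong[OF S, rotated])
    fix p assume "p \<in> S"
    then have "V p = (\<chi> k. det (\<chi> i j. if j = k then W p $ i else A p $ i $ j) / det (A p))"
      using cramer[OF det] V by blast
    then show "det (?B p) * inverse (det (A p)) = V p $ k"
      by (simp add: divide_inverse)
  qed
qed

lemma holo_matrix_derivative_nth: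
  fixes A :: "'a::real_normed_vector \<Rightarrow> complex^'m^'k"
  assumes A: "\<And>i j. holo sc (\<lambda>p. A p $ i $ j) S" and p: "p \<in> S"
  shows "frechet_derivative (\<lambda>q. A q $ i $ j) (at p) v = frechet_derivative A (at p) v $ i $ j"
proof -
  have "(A has_derivative (\<lambda>v. \<chi> i j. frechet_derivative (\<lambda>q. A q $ i $ j) (at p) v)) (at p)"
    using holo_has_derivative[OF A p] by (simp add: has_derivative_vec_iff)
  from frechet_derivative_at[OF this, symmetric] show ?thesis by simp
qed

section \<open>The last row of the equations and the bundle map \<open>\<phi>\<close>\<close>

locale okubo_equations =
  fixes U :: "('n::{finite,linorder}) cvec set"
    and T :: "'n cvec \<Rightarrow> 'n cmat"
    and Om :: "'n cvec \<Rightarrow> 'n cvec \<Rightarrow> 'n cmat"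
    and lam :: "'n \<Rightarrow> complex"
  assumes open_U: "open U"
    and holo_T: "holo (*s) (\<lambda>p. T p $ i $ j) U"
    and holo_Om: "holo_matrix_form U Om"
    and nonresonant: "i \<noteq> j \<Longrightarrow> lam i - lam j \<notin> \<int> - {0}"
    and T_Om_commute: "p \<in> U \<Longrightarrow> T p ** Om p v = Om p v ** T p"
    and Om_commute: "p \<in> U \<Longrightarrow> Om p u ** Om p v = Om p v ** Om p u"
    and dT: "p \<in> U \<Longrightarrow>
      frechet_derivative T (at p) v + Om p v + (Om p v ** diag lam - diag lam ** Om p v) = 0"
    and dOm: "p \<in> U \<Longrightarrow> ext_deriv Om p u v = 0"
begin

abbreviation "n \<equiv> (last_index :: 'n)"

text \<open>In the last row of the equation for \<open>dT\<close> the commutator contributes the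
  difference and \<open>Om\<close> itself the 1. The matrix \<open>diag shift\<close> will turn out
  to be \<open>\<nabla>\<^sup>0 E\<close> in the frame \<open>\<phi>\<close>.\<close>

definition shift :: "'n \<Rightarrow> complex" where
  "shift j = lam j - lam n + 1"

definition flat_map :: "'n cvec \<Rightarrow> 'n cvec" where
  "flat_map p = (\<chi> j. - inverse (shift j) * T p $ n $ j)"

abbreviation "\<phi> \<equiv> ind_phi Om"

text \<open>In the trivial frame \<open>act\<close> is the Higgs field, and \<open>Tt\<close> below
  is minus the endomorphism \<open>\<Phi>(E)\<close>.\<close>

definition act :: "'n cvec \<Rightarrow> 'n cvec \<Rightarrow> 'n cmat" where
  "act p v = transpose (Om p v)"

definition Tt :: "'n cvec \<Rightarrow> 'n cmat" where
  "Tt p = transpose (T p)"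

lemma act_nth: "act p v $ i $ j = Om p v $ j $ i"
  by (simp add: act_def transpose_def)

lemma Tt_nth: "Tt p $ i $ j = T p $ j $ i"
  by (simp add: Tt_def transpose_def)

text \<open>A zero would mean \<open>lam j - lam n = - 1\<close>, which nonresonance forbids for
  \<open>j \<noteq> n\<close>; at \<open>j = n\<close> the value is 1.\<close>

lemma shift_nonzero: "shift j \<noteq> 0"
proof (cases "j = n")
  case False
  have "lam j - lam n \<noteq> - 1"
    using nonresonant[OF False] by force
  then show ?thesis by (simp add: shift_def eq_neg_iff_add_eq_0)
qed (simp add: shift_def)

lemma Om_linear:
  assumes "p \<in> U"
  shows Om_add: "Om p (u + v) = Om p u + Om p v"
    and Om_scale: "Om p (c *s v) $ i $ j = c * Om p v $ i $ j"
  using holo_Om assms unfolding holo_matrix_form_def Vector_Spaces.linear_iff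
  by (simp_all add: vec_eq_iff)

lemma phi_act: "\<phi> p v = act p v *v axis n 1"
  unfolding ind_phi_def act_def ..

lemma phi_nth: "\<phi> p v $ j = Om p v $ n $ j"
  by (simp add: phi_act matrix_vector_mult_axis act_nth)

text \<open>The commutator with a diagonal matrix rescales each entry separately, so the matrix
  equation decouples.\<close>

lemma dT_nth:
  assumes p: "p \<in> U"
  shows "frechet_derivative (\<lambda>q. T q $ i $ j) (at p) v = - (lam j - lam i + 1) * Om p v $ i $ j"
proof -
  have "frechet_derivative (\<lambda>q. T q $ i $ j) (at p) v = frechet_derivative T (at p) v $ i $ j"
    by (rule holo_matrix_derivative_nth[OF holo_T p])
  moreover have "(frechet_derivative T (at p) v + Om p v + (Om p v ** diag lam - diag lam ** Om p v)) $ i $ j = 0"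
    by (simp add: dT[OF p])
  ultimately show ?thesis
    by (simp add: diag_mult_nth algebra_simps eq_neg_iff_add_eq_0)
qed

lemma holo_flat_map: "holo_map (*s) flat_map U"
  unfolding holo_map_def flat_map_def by (simp add: holo_mult[OF holo_const] holo_minus holo_T)

lemma flat_map_derivative_nth:
  assumes p: "p \<in> U"
  shows "frechet_derivative (\<lambda>q. - inverse (shift j) * T q $ n $ j) (at p) v = Om p v $ n $ j"
proof -
  have "((\<lambda>q. - inverse (shift j) * T q $ n $ j) has_derivative
      (\<lambda>v. - inverse (shift j) * frechet_derivative (\<lambda>q. T q $ n $ j) (at p) v)) (at p)"
    by (rule has_derivative_mult_right[OF holo_has_derivative[OF holo_T p]])
  from fun_cong[OF frechet_derivative_at[OF this], of v]
  have "frechet_derivative (\<lambda>q. - inverse (shift j) * T q $ n $ j) (at p) v =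
      - inverse (shift j) * (- shift j * Om p v $ n $ j)"
    unfolding dT_nth[OF p] shift_def[symmetric] by (rule sym)
  also have "\<dots> = Om p v $ n $ j"
    using shift_nonzero[of j] by simp
  finally show ?thesis .
qed

text \<open>The division by \<open>shift\<close> in \<open>flat_map\<close> is made for this:
  \<open>\<phi>\<close> becomes an exact form, so that torsion-freeness reduces to the symmetry of
  second derivatives.\<close>

lemma phi_eq_derivative: "p \<in> U \<Longrightarrow> \<phi> p v = frechet_derivative flat_map (at p) v"
  by (simp add: vec_eq_iff phi_nth holo_map_derivative_nth[OF holo_flat_map])
    (simp add: flat_map_def flat_map_derivative_nth[symmetric])

lemma phi_add: "p \<in> U \<Longrightarrow> \<phi> p (u + v) = \<phi> p u + \<phi> p v"
  by (simp add: vec_eq_iff phi_nth Om_add)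

lemma phi_scale: "p \<in> U \<Longrightarrow> \<phi> p (c *s v) = c *s \<phi> p v"
  by (simp add: vec_eq_iff phi_nth Om_scale)

lemma phi_diff: "p \<in> U \<Longrightarrow> \<phi> p (u - v) = \<phi> p u - \<phi> p v"
  using phi_add[of p "u - v" v] by (simp add: algebra_simps)

lemma phi_zero: "p \<in> U \<Longrightarrow> \<phi> p 0 = 0"
  using phi_diff[of p 0 0] by simp

lemma holo_map_phi: "holo_map (*s) Y U \<Longrightarrow> holo_map (*s) (\<lambda>p. \<phi> p (Y p)) U"
  by (rule holo_map_cong[OF open_U _ holo_map_derivative_along[OF holo_flat_map _ open_U]])
    (simp_all add: phi_eq_derivative)

text \<open>The matrix of \<open>\<phi> p\<close> in the standard bases, which is also the Jacobian
  matrix of \<open>flat_map\<close>.\<close>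

definition phi_matrix :: "'n cvec \<Rightarrow> 'n cmat" where
  "phi_matrix p = (\<chi> i k. Om p (axis k 1) $ n $ i)"

lemma Om_expand: "p \<in> U \<Longrightarrow> Om p v $ i $ j = (\<Sum>k\<in>UNIV. v $ k * Om p (axis k 1) $ i $ j)"
proof -
  assume p: "p \<in> U"
  then interpret Vector_Spaces.linear "(*s)" "(*)" "\<lambda>v. Om p v $ i $ j"
    using holo_Om unfolding holo_matrix_form_def by blast
  show ?thesis
    by (subst vec_eq_sum_axis[of v]) (simp only: sum scale)
qed

lemma phi_matrix_mult: "p \<in> U \<Longrightarrow> phi_matrix p *v v = \<phi> p v"
  by (simp add: vec_eq_iff phi_matrix_def phi_nth matrix_vector_mult_def Om_expand[of p v] mult.commute)

lemma bij_phi_iff: "p \<in> U \<Longrightarrow> bij (\<phi> p) \<longleftrightarrow> det (phi_matrix p) \<noteq> 0"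
  using invertible_eq_bij[of "phi_matrix p"] ext[of "(*v) (phi_matrix p)" "\<phi> p", OF phi_matrix_mult]
  by (simp add: invertible_det_nz[symmetric])

lemma holo_phi_matrix: "holo (*s) (\<lambda>p. phi_matrix p $ i $ k) U"
  using holo_Om unfolding holo_matrix_form_def phi_matrix_def by simp

text \<open>The matrix of values factors as a diagonal matrix, the matrix of \<open>\<phi>\<close>
  and the matrix of the arguments. The determinant of the first is nonzero, so the form vanishes
  identically exactly when \<open>det (phi_matrix p) = 0\<close>.\<close>

lemma wedge_dT_nonzero_iff:
  assumes p: "p \<in> U"
  shows "wedge UNIV (\<lambda>j. frechet_derivative (\<lambda>q. T q $ n $ j) (at p)) \<noteq> (\<lambda>_. 0) \<longleftrightarrow> bij (\<phi> p)"
proof -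
  have "(\<chi> i j. frechet_derivative (\<lambda>q. T q $ n $ i) (at p) (v j)) =
      diag (\<lambda>i. - shift i) ** (phi_matrix p ** (\<chi> k j. v j $ k))" for v :: "'n \<Rightarrow> 'n cvec"
  proof -
    have "(phi_matrix p ** (\<chi> k j. v j $ k)) $ i $ j = \<phi> p (v j) $ i" for i j
      unfolding phi_matrix_mult[OF p, symmetric]
      by (simp add: matrix_matrix_mult_def matrix_vector_mult_def)
    then show ?thesis
      unfolding vec_eq_iff diag_mult_nth by (simp add: dT_nth[OF p] phi_nth shift_def)
  qed
  then have w: "wedge UNIV (\<lambda>j. frechet_derivative (\<lambda>q. T q $ n $ j) (at p)) v =
      (\<Prod>i\<in>UNIV. - shift i) * (det (phi_matrix p) * det (\<chi> k j. v j $ k))" for v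
    by (simp add: wedge_UNIV det_mul det_diag)
  \<comment> \<open>The standard basis has determinant 1 and so detects a nonzero form.\<close>
  have "det (\<chi> k j. axis (j::'n) (1::complex) $ k) = 1"
    using det_I by (simp add: axis_def mat_def)
  then have "det (phi_matrix p) \<noteq> 0 \<Longrightarrow>
      wedge UNIV (\<lambda>j. frechet_derivative (\<lambda>q. T q $ n $ j) (at p)) (\<lambda>j. axis j 1) \<noteq> 0"
    using shift_nonzero by (simp add: w)
  then show ?thesis
    unfolding bij_phi_iff[OF p] using w by (auto simp: fun_eq_iff)
qed

lemma act_commute: "p \<in> U \<Longrightarrow> act p u *v (act p v *v x) = act p v *v (act p u *v x)"
  unfolding matrix_vector_mul_assoc act_def matrix_transpose_mul[symmetric] by (simp only: Om_commute)

lemma act_T_commute: "p \<in> U \<Longrightarrow> act p u *v (Tt p *v x) = Tt p *v (act p u *v x)"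
  unfolding matrix_vector_mul_assoc act_def Tt_def matrix_transpose_mul[symmetric]
  by (simp only: T_Om_commute)

lemma holo_map_act: "holo_map (*s) x U \<Longrightarrow> holo_map (*s) (\<lambda>p. act p v *v x p) U"
  using holo_Om unfolding holo_map_def holo_matrix_form_def
  by (auto simp: matrix_vector_mult_def act_nth intro!: holo_sum holo_mult)

end

section \<open>The axioms of the structure when \<open>\<phi>\<close> is bijective\<close>

locale okubo_frame = okubo_equations U T Om lam
  for U :: "('n::{finite,linorder}) cvec set" and T Om lam +
  assumes bij_phi: "p \<in> U \<Longrightarrow> bij (ind_phi Om p)"
begin

lemma phi_inv [simp]: "p \<in> U \<Longrightarrow> \<phi> p (inv (\<phi> p) w) = w"
  by (simp add: bij_is_surj[OF bij_phi] surj_f_inv_f)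

text \<open>Identities between tangent vectors are checked after applying \<open>\<phi>\<close>,
  where \<open>\<nabla>\<^sup>0\<close> becomes \<open>d\<close> and \<open>\<Phi>\<close> becomes
  \<open>act\<close>.\<close>

lemma phi_eqI: "p \<in> U \<Longrightarrow> \<phi> p u = \<phi> p v \<Longrightarrow> u = v"
  using bij_is_inj[OF bij_phi] by (meson injD)

lemma holo_map_inv_phi:
  assumes "holo_map (*s) W U"
  shows "holo_map (*s) (\<lambda>p. inv (\<phi> p) (W p)) U"
  using bij_phi bij_phi_iff
  by (intro holo_map_linear_preimage[OF open_U holo_phi_matrix _ assms]) (auto simp: phi_matrix_mult)

lemma phi_nabla:
  "p \<in> U \<Longrightarrow> \<phi> p (ind_nabla Om X Y p) = frechet_derivative (\<lambda>q. \<phi> q (Y q)) (at p) (X p)"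
  by (simp add: ind_nabla_def)

lemma phi_Phi: "p \<in> U \<Longrightarrow> \<phi> p (ind_Phi Om p u v) = act p u *v \<phi> p v"
  by (simp add: ind_Phi_def act_def)

lemma phi_e: "p \<in> U \<Longrightarrow> \<phi> p (ind_e Om p) = axis n 1"
  by (simp add: ind_e_def)

lemma phi_E: "p \<in> U \<Longrightarrow> \<phi> p (ind_E T Om p) = - (Tt p *v axis n 1)"
  using phi_diff[of p 0 "inv (\<phi> p) (Tt p *v axis n 1)"]
  unfolding ind_E_def Tt_def[symmetric] by (simp add: phi_zero)

lemma frechet_phi_scale:
  assumes f: "holo (*s) f U" and Y: "holo_map (*s) Y U" and p: "p \<in> U"
  shows "frechet_derivative (\<lambda>q. \<phi> q (f q *s Y q)) (at p) h =
    frechet_derivative f (at p) h *s \<phi> p (Y p) + f p *s frechet_derivative (\<lambda>q. \<phi> q (Y q)) (at p) h"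
proof -
  have "((\<lambda>q. f q *s \<phi> q (Y q)) has_derivative (\<lambda>h. f p *s frechet_derivative (\<lambda>q. \<phi> q (Y q)) (at p) h
        + frechet_derivative f (at p) h *s \<phi> p (Y p))) (at p)"
    by (rule bounded_bilinear.FDERIV[OF bounded_bilinear_vector_scalar_mult
          holo_has_derivative[OF f p] holo_map_has_derivative[OF holo_map_phi[OF Y] p]])
  from fun_cong[OF frechet_derivative_at[OF this], of h]
  show ?thesis
    by (simp add: frechet_derivative_cong_open[OF open_U p phi_scale] add.commute)
qed

lemma frechet_phi_add:
  assumes Y: "holo_map (*s) Y U" and Y': "holo_map (*s) Y' U" and p: "p \<in> U"
  shows "frechet_derivative (\<lambda>q. \<phi> q (Y q + Y' q)) (at p) h =
    frechet_derivative (\<lambda>q. \<phi> q (Y q)) (at p) h + frechet_derivative (\<lambda>q. \<phi> q (Y' q)) (at p) h"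
  using fun_cong[OF frechet_derivative_at[OF has_derivative_add
      [OF holo_map_has_derivative[OF holo_map_phi[OF Y] p] holo_map_has_derivative[OF holo_map_phi[OF Y'] p]]], of h]
  by (simp add: frechet_derivative_cong_open[OF open_U p phi_add])

lemma holo_connection_nabla: "holo_connection U (ind_nabla Om)"
  unfolding holo_connection_def vector_field_def
proof (intro conjI allI impI ballI; (elim conjE)?)
  fix X Y :: "'n cvec \<Rightarrow> 'n cvec" assume X: "holo_map (*s) X U" and Y: "holo_map (*s) Y U"
  show "holo_map (*s) (ind_nabla Om X Y) U"
    unfolding ind_nabla_def
    by (rule holo_map_inv_phi[OF holo_map_derivative_along[OF holo_map_phi[OF Y] X open_U]])
next
  fix X X' Y :: "'n cvec \<Rightarrow> 'n cvec" and p assume Y: "holo_map (*s) Y U" and p: "p \<in> U"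
  interpret bounded_linear "frechet_derivative (\<lambda>q. \<phi> q (Y q)) (at p)"
    by (rule has_derivative_bounded_linear[OF holo_map_has_derivative[OF holo_map_phi[OF Y] p]])
  show "ind_nabla Om (\<lambda>q. X q + X' q) Y p = ind_nabla Om X Y p + ind_nabla Om X' Y p"
    by (rule phi_eqI[OF p]) (simp add: p phi_add phi_nabla add)
next
  fix f and X Y :: "'n cvec \<Rightarrow> 'n cvec" and p assume Y: "holo_map (*s) Y U" and p: "p \<in> U"
  show "ind_nabla Om (\<lambda>q. f q *s X q) Y p = f p *s ind_nabla Om X Y p"
    by (rule phi_eqI[OF p])
      (simp add: p phi_scale phi_nabla holo_map_derivative_scale[OF holo_map_phi[OF Y] p])
next
  fix X Y Y' :: "'n cvec \<Rightarrow> 'n cvec" and p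
  assume Y: "holo_map (*s) Y U" "holo_map (*s) Y' U" and p: "p \<in> U"
  show "ind_nabla Om X (\<lambda>q. Y q + Y' q) p = ind_nabla Om X Y p + ind_nabla Om X Y' p"
    by (rule phi_eqI[OF p]) (simp add: p phi_add phi_nabla frechet_phi_add[OF Y p])
next
  fix f and X Y :: "'n cvec \<Rightarrow> 'n cvec" and p
  assume fY: "holo (*s) f U" "holo_map (*s) Y U" and p: "p \<in> U"
  show "ind_nabla Om X (\<lambda>q. f q *s Y q) p =
      frechet_derivative f (at p) (X p) *s Y p + f p *s ind_nabla Om X Y p"
    by (rule phi_eqI[OF p]) (simp add: p phi_add phi_scale phi_nabla frechet_phi_scale[OF fY p])
qed

text \<open>After \<open>\<phi>\<close>, iterated covariant derivatives of \<open>Z\<close> are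
  iterated derivatives of the map \<open>\<phi>(Z)\<close>, whose commutator is the derivative along
  the bracket.\<close>

lemma flat_connection_nabla: "flat_connection U (ind_nabla Om)"
  unfolding flat_connection_def vector_field_def
proof (intro allI impI ballI; elim conjE)
  fix X Y Z :: "'n cvec \<Rightarrow> 'n cvec" and p
  assume X: "holo_map (*s) X U" and Y: "holo_map (*s) Y U" and Z: "holo_map (*s) Z U" and p: "p \<in> U"
  let ?D = "ind_nabla Om"
  have "\<phi> p (?D X (?D Y Z) p) = frechet_derivative (\<lambda>q. frechet_derivative (\<lambda>r. \<phi> r (Z r)) (at q) (Y q)) (at p) (X p)"
    for X Y by (simp add: phi_nabla[OF p] frechet_derivative_cong_open[OF open_U p phi_nabla])
  then have "\<phi> p (?D X (?D Y Z) p - ?D Y (?D X Z) p) = \<phi> p (?D (lie_bracket X Y) Z p)"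
    using derivative_along_commutator[OF bounded_bilinear_vector_scalar_mult holo_map_phi[OF Z] open_U p
        holo_map_differentiable[OF X p] holo_map_differentiable[OF Y p]]
    by (simp add: phi_diff[OF p] phi_nabla[OF p])
  then show "?D X (?D Y Z) p - ?D Y (?D X Z) p - ?D (lie_bracket X Y) Z p = 0"
    using phi_eqI[OF p] by simp
qed

text \<open>Here the commutator identity is applied to \<open>flat_map\<close>, since
  \<open>\<phi>(Y)\<close> is its derivative along \<open>Y\<close>.\<close>

lemma torsion_free_nabla: "torsion_free U (ind_nabla Om)"
  unfolding torsion_free_def vector_field_def
proof (intro allI impI ballI; elim conjE)
  fix X Y :: "'n cvec \<Rightarrow> 'n cvec" and p
  assume X: "holo_map (*s) X U" and Y: "holo_map (*s) Y U" and p: "p \<in> U"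
  have "\<phi> p (ind_nabla Om X Y p) = frechet_derivative (\<lambda>q. frechet_derivative flat_map (at q) (Y q)) (at p) (X p)"
    for X Y by (simp add: phi_nabla[OF p] frechet_derivative_cong_open[OF open_U p phi_eq_derivative])
  then have "\<phi> p (ind_nabla Om X Y p - ind_nabla Om Y X p) = \<phi> p (lie_bracket X Y p)"
    using derivative_along_commutator[OF bounded_bilinear_vector_scalar_mult holo_flat_map open_U p
        holo_map_differentiable[OF X p] holo_map_differentiable[OF Y p]]
    by (simp only: phi_diff[OF p] phi_eq_derivative[OF p, of "lie_bracket X Y p"])
  then show "ind_nabla Om X Y p - ind_nabla Om Y X p = lie_bracket X Y p"
    by (rule phi_eqI[OF p])
qed

text \<open>Since \<open>\<phi> p v\<close> is \<open>act p v\<close> applied to the last frame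
  vector, both sides are products of commuting matrices applied to that vector.\<close>

lemma Phi_commute:
  assumes p: "p \<in> U"
  shows "ind_Phi Om p u v = ind_Phi Om p v u"
proof (rule phi_eqI[OF p])
  have "act p u *v \<phi> p v = act p v *v \<phi> p u"
    by (simp add: phi_act act_commute[OF p, of u v])
  then show "\<phi> p (ind_Phi Om p u v) = \<phi> p (ind_Phi Om p v u)"
    by (simp only: phi_Phi[OF p])
qed

lemma Phi_assoc:
  assumes p: "p \<in> U"
  shows "ind_Phi Om p (ind_Phi Om p u v) w = ind_Phi Om p u (ind_Phi Om p v w)"
proof (rule phi_eqI[OF p])
  \<comment> \<open>Commutativity moves the inner product into the second slot, where
    \<open>phi_Phi\<close> unfolds it; the three commuting matrices can then be reordered.\<close>
  have "\<phi> p (ind_Phi Om p (ind_Phi Om p u v) w) = act p w *v (act p u *v \<phi> p v)"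
    by (simp add: Phi_commute[OF p, of _ w] phi_Phi[OF p])
  also have "\<dots> = act p u *v (act p v *v \<phi> p w)"
    by (simp only: phi_act act_commute[OF p, of w u] act_commute[OF p, of w v])
  also have "\<dots> = \<phi> p (ind_Phi Om p u (ind_Phi Om p v w))"
    by (simp add: phi_Phi[OF p])
  finally show "\<phi> p (ind_Phi Om p (ind_Phi Om p u v) w) = \<phi> p (ind_Phi Om p u (ind_Phi Om p v w))" .
qed

lemma symmetric_higgs_field_Phi: "symmetric_higgs_field U (ind_Phi Om)"
  unfolding symmetric_higgs_field_def
proof (intro conjI ballI allI)
  fix p v assume p: "p \<in> U"
  have lin: "Vector_Spaces.linear (*s) (*s) (ind_Phi Om p v)"
    unfolding Vector_Spaces.linear_iff
  proof (intro conjI allI vec.vector_space_axioms)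
    show "ind_Phi Om p v (x + y) = ind_Phi Om p v x + ind_Phi Om p v y" for x y
      by (rule phi_eqI[OF p]) (simp add: p phi_Phi phi_add matrix_vector_right_distrib)
    show "ind_Phi Om p v (c *s x) = c *s ind_Phi Om p v x" for c x
      by (rule phi_eqI[OF p]) (simp add: p phi_Phi phi_scale vector_scalar_commute)
  qed
  then show "Vector_Spaces.linear (*s) (*s) (ind_Phi Om p v)" .
  show "Vector_Spaces.linear (*s) (*s) (\<lambda>u. ind_Phi Om p u v)"
    using lin by (simp add: Phi_commute[OF p, of _ v])
next
  fix u v
  show "holo_map (*s) (\<lambda>p. ind_Phi Om p u v) U"
    unfolding ind_Phi_def act_def[symmetric] by (intro holo_map_inv_phi holo_map_act holo_map_phi) (simp add: holo_map_def)
qed (simp_all add: Phi_assoc, rule Phi_commute)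

lemma holo_map_e: "holo_map (*s) (ind_e Om) U"
  unfolding ind_e_def by (rule holo_map_inv_phi) (simp add: holo_map_def)

lemma holo_map_E: "holo_map (*s) (ind_E T Om) U"
proof -
  have "holo_map (*s) (\<lambda>p. Tt p *v axis n 1) U"
    by (simp add: holo_map_def matrix_vector_mult_axis Tt_nth holo_T)
  from holo_map_inv_phi[OF this] show ?thesis
    unfolding ind_E_def[abs_def] Tt_def[symmetric] holo_map_def by (simp add: holo_minus)
qed

lemma nabla_e:
  assumes p: "p \<in> U"
  shows "ind_nabla Om X (ind_e Om) p = 0"
  by (rule phi_eqI[OF p]) (simp add: p phi_nabla phi_zero frechet_derivative_cong_open[OF open_U p phi_e])

text \<open>After exchanging the factors, \<open>act p v\<close> hits the last frame vector, and
  this is \<open>\<phi> p v\<close> by definition.\<close>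

lemma Phi_e:
  assumes p: "p \<in> U"
  shows "ind_Phi Om p (ind_e Om p) v = v"
  by (rule phi_eqI[OF p], subst Phi_commute[OF p]) (simp only: phi_Phi[OF p] phi_e[OF p] phi_act[of p v])

text \<open>The Jacobian matrix of these functions is the matrix of \<open>\<phi>\<close>, so
  \<open>\<phi>\<close> sends each coordinate field to a constant frame vector, which
  \<open>d\<close> annihilates.\<close>

lemma flat_coordinates_nabla:
  "flat_coordinates U (ind_nabla Om) (\<lambda>j p. - inverse (lam j - lam n + 1) * T p $ n $ j)"
  unfolding flat_coordinates_def shift_def[symmetric]
proof (intro conjI allI impI ballI)
  let ?t = "\<lambda>j p. - inverse (shift j) * T p $ n $ j"
  have jac: "jacobian ?t p = phi_matrix p" if "p \<in> U" for p
    unfolding jacobian_def phi_matrix_def flat_map_derivative_nth[OF that] ..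
  show "holo (*s) (?t j) U" for j
    by (intro holo_mult holo_const holo_T)
  fix p assume p: "p \<in> U"
  show "det (jacobian ?t p) \<noteq> 0"
    using bij_phi[OF p] bij_phi_iff[OF p] unfolding jac[OF p] by simp
  fix i and X :: "'n cvec \<Rightarrow> 'n cvec"
  have "\<phi> q (coordinate_field ?t i q) = axis i 1" if q: "q \<in> U" for q
  proof -
    have "invertible (phi_matrix q)"
      using bij_phi[OF q] bij_phi_iff[OF q] by (simp add: invertible_det_nz)
    then have "phi_matrix q *v (matrix_inv (phi_matrix q) *v axis i 1) = axis i 1"
      by (simp add: matrix_vector_mul_assoc matrix_mult_matrix_inv)
    moreover have "coordinate_field ?t i q = matrix_inv (phi_matrix q) *v axis i 1"
      unfolding coordinate_field_def jac[OF q]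
      by (simp add: vec_eq_iff column_def matrix_vector_mult_axis)
    ultimately show ?thesis
      by (simp only: phi_matrix_mult[OF q])
  qed
  note const = frechet_derivative_cong_open[OF open_U p this]
  show "ind_nabla Om X (coordinate_field ?t i) p = 0"
    by (rule phi_eqI[OF p]) (simp only: phi_nabla[OF p] const phi_zero[OF p] frechet_derivative_const)
qed

end

section \<open>Integrability of the Saito connection\<close>

lemma holo_snd:
  assumes "holo (*s) f U"
  shows "holo scale_prod (\<lambda>w. f (snd w)) (A \<times> U)"
proof (rule holoI)
  fix w assume "w \<in> A \<times> U"
  then have w: "snd w \<in> U" by auto
  show "((\<lambda>w. f (snd w)) has_derivative (\<lambda>h. frechet_derivative f (at (snd w)) (snd h))) (at w)"
    by (rule has_derivative_compose[OF has_derivative_snd[OF has_derivative_ident] holo_has_derivative[OF assms w]])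
  show "frechet_derivative f (at (snd w)) (snd (scale_prod c h)) = c * frechet_derivative f (at (snd w)) (snd h)" for c h
    by (simp add: scale_prod_def holo_derivative_scale[OF assms w])
qed

lemma matrix_vector_mult_lincomb:
  fixes A B C :: "complex^'n^'m"
  assumes "\<And>i j. A $ i $ j = c * B $ i $ j - d * C $ i $ j"
  shows "A *v x = c *s (B *v x) - d *s (C *v x)"
  by (simp add: assms vec_eq_iff matrix_vector_mult_def sum_distrib_left sum_subtractf[symmetric]
      left_diff_distrib mult.assoc)

section \<open>The connection matrix in the frame \<open>\<phi>\<close> and its curvature\<close>

context okubo_frame
begin

lemma dOm_nth:
  assumes p: "p \<in> U"
  shows "frechet_derivative (\<lambda>q. Om q v $ i $ j) (at p) u = frechet_derivative (\<lambda>q. Om q u $ i $ j) (at p) v"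
proof -
  have ho: "holo (*s) (\<lambda>p. Om p v $ i $ j) U" for v i j
    using holo_Om unfolding holo_matrix_form_def by blast
  have "frechet_derivative (\<lambda>q. Om q v $ i $ j) (at p) u = frechet_derivative (\<lambda>q. Om q v) (at p) u $ i $ j" for u v
    by (rule holo_matrix_derivative_nth[OF ho p])
  then show ?thesis
    using dOm[OF p, of u v] by (simp add: ext_deriv_def)
qed

text \<open>The matrix of the Saito connection in the frame \<open>\<phi>\<close> at the point
  \<open>w\<close>, in the direction \<open>V\<close>. The term with \<open>Tt\<close> has a plus
  sign because \<open>\<Phi>(E)\<close> is \<open>- Tt\<close>.\<close>

definition conn_form :: "complex \<times> 'n cvec \<Rightarrow> complex \<times> 'n cvec \<Rightarrow> 'n cmat" where
  "conn_form w V = (\<chi> i j. 1 / fst w * act (snd w) (snd V) $ i $ j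
     + fst V / (fst w)\<^sup>2 * Tt (snd w) $ i $ j - fst V / fst w * diag shift $ i $ j)"

lemma conn_form_mult: "conn_form w V *v x = (1 / fst w) *s (act (snd w) (snd V) *v x)
    + (fst V / (fst w)\<^sup>2) *s (Tt (snd w) *v x) - (fst V / fst w) *s (diag shift *v x)"
  by (simp add: vec_eq_iff conn_form_def matrix_vector_mult_def sum_distrib_left sum.distrib
      sum_subtractf distrib_right left_diff_distrib mult.assoc)

lemma conn_form_diff: "snd w \<in> U \<Longrightarrow> conn_form w (V - W) = conn_form w V - conn_form w W"
  by (simp add: vec_eq_iff conn_form_def act_nth Om_expand[of _ "_ - _"] Om_expand[of _ "snd V"]
      Om_expand[of _ "snd W"] left_diff_distrib right_diff_distrib sum_subtractf diff_divide_distrib)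

text \<open>In flat coordinates \<open>E\<close> is the linear field with components
  \<open>shift j * t_j\<close>, so its covariant derivative is the constant diagonal matrix of the
  weights.\<close>

lemma dE: "p \<in> U \<Longrightarrow> frechet_derivative (\<lambda>q. \<phi> q (ind_E T Om q)) (at p) v = diag shift *v \<phi> p v"
proof -
  assume p: "p \<in> U"
  have h: "holo_map (*s) (\<lambda>q. - (Tt q *v axis n 1)) U"
    by (simp add: holo_map_def matrix_vector_mult_axis Tt_nth holo_T holo_minus)
  have "frechet_derivative (\<lambda>q. - T q $ n $ j) (at p) v = shift j * Om p v $ n $ j" for j
    using fun_cong[OF frechet_derivative_at[OF has_derivative_minus[OF holo_has_derivative[OF holo_T[of n j] p]]], of v, symmetric]
    unfolding dT_nth[OF p] shift_def by (simp add: algebra_simps)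
  then show ?thesis
    by (simp add: frechet_derivative_cong_open[OF open_U p phi_E] vec_eq_iff holo_map_derivative_nth[OF h p]
        diag_mult_vec_nth phi_nth matrix_vector_mult_axis Tt_nth)
qed

lemma bounded_linear_inv_phi:
  assumes p: "p \<in> U"
  shows "bounded_linear (inv (\<phi> p))"
  unfolding linear_conv_bounded_linear[symmetric]
proof (rule linearI)
  have scaleR: "r *\<^sub>R x = complex_of_real r *s x" for r and x :: "'n cvec"
    by (simp add: vec_eq_iff) (simp add: scaleR_conv_of_real)
  show "inv (\<phi> p) (x + y) = inv (\<phi> p) x + inv (\<phi> p) y" for x y
    by (rule phi_eqI[OF p]) (simp add: p phi_add)
  show "inv (\<phi> p) (r *\<^sub>R x) = r *\<^sub>R inv (\<phi> p) x" for r x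
    by (rule phi_eqI[OF p]) (simp add: p scaleR phi_scale)
qed

abbreviation "N \<equiv> saito_nabla (ind_nabla Om) (ind_Phi Om) (ind_E T Om)"

abbreviation frame :: "(complex \<times> 'n cvec \<Rightarrow> 'n cvec) \<Rightarrow> complex \<times> 'n cvec \<Rightarrow> 'n cvec" where
  "frame Y \<equiv> \<lambda>w. \<phi> (snd w) (Y w)"

text \<open>Differentiability of \<open>frame Y\<close> at the single point \<open>w\<close> is
  assumed rather than holomorphy of \<open>Y\<close>, so that the formula also applies to a section
  of the form \<open>N Z Y\<close>.\<close>

lemma phi_saito_nabla:
  assumes p: "snd w \<in> U" and Y: "frame Y differentiable at w"
  shows "\<phi> (snd w) (N V Y w) = frechet_derivative (frame Y) (at w) (V w) + conn_form w (V w) *v frame Y w"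
proof -
  obtain z p where w: "w = (z, p)" by (cases w)
  have p: "p \<in> U" using p w by simp
  let ?y' = "frechet_derivative (frame Y) (at (z, p))"
  have y': "(frame Y has_derivative ?y') (at (z, p))"
    using Y frechet_derivative_works w by blast
  interpret y': bounded_linear ?y'
    by (rule has_derivative_bounded_linear[OF y'])
  interpret inv_phi: bounded_linear "inv (\<phi> p)"
    by (rule bounded_linear_inv_phi[OF p])
  \<comment> \<open>Along the \<open>z\<close>-axis the base point \<open>p\<close> is fixed, so
    \<open>\<phi> p\<close> is a constant linear isomorphism and commutes with the
    derivative.\<close>
  have "((\<lambda>x. \<phi> p (Y (x, p))) has_derivative (\<lambda>h. ?y' (h, 0))) (at z)"
    using has_derivative_compose[of "\<lambda>x. (x, p)" "\<lambda>h. (h, 0)" z UNIV "frame Y" ?y'] y'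
    by (simp add: has_derivative_Pair)
  from inv_phi.has_derivative[OF this]
  have "((\<lambda>x. Y (x, p)) has_derivative (\<lambda>h. inv (\<phi> p) (?y' (h, 0)))) (at z)"
    using bij_is_inj[OF bij_phi[OF p]] by (simp add: inv_f_f)
  then have dz: "\<phi> p (frechet_derivative (\<lambda>x. Y (x, p)) (at z) a) = ?y' (a, 0)" for a
    using p by (simp add: frechet_derivative_at[symmetric])
  have "((\<lambda>q. \<phi> q (Y (z, q))) has_derivative (\<lambda>h. ?y' (0, h))) (at p)"
    using has_derivative_compose[of "\<lambda>q. (z, q)" "\<lambda>h. (0, h)" p UNIV "frame Y" ?y'] y'
    by (simp add: has_derivative_Pair)
  from fun_cong[OF frechet_derivative_at[OF this]]
  have dX: "\<phi> p (ind_nabla Om X (\<lambda>q. Y (z, q)) p) = ?y' (0, X p)" for X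
    by (simp add: phi_nabla[OF p])
  \<comment> \<open>Commutation of \<open>Om\<close> with \<open>T\<close> moves \<open>act\<close>
    past \<open>Tt\<close> onto the last frame vector; this is how \<open>\<Phi>(E)\<close> becomes
    \<open>- Tt\<close>.\<close>
  have actE: "act p v *v \<phi> p (ind_E T Om p) = - (Tt p *v \<phi> p v)" for v
  proof -
    have "act p v *v \<phi> p (ind_E T Om p) = - (act p v *v (Tt p *v axis n 1))"
      using matrix_vector_mult_diff_distrib[of "act p v" 0] by (simp add: phi_E[OF p])
    also have "\<dots> = - (Tt p *v \<phi> p v)"
      by (simp only: act_T_commute[OF p] phi_act)
    finally show ?thesis .
  qed
  have nE: "\<phi> p (ind_nabla Om X (ind_E T Om) p) = diag shift *v \<phi> p (X p)" for X
    by (simp only: phi_nabla[OF p] dE[OF p])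
  have "?y' (fst (V w), 0) + ?y' (0, snd (V w)) = ?y' (V w)"
    by (simp add: y'.add[symmetric])
  then show ?thesis
    by (simp add: w saito_nabla_def Let_def phi_add[OF p] phi_diff[OF p] phi_scale[OF p] dz dX nE actE
        phi_Phi[OF p] conn_form_mult)
      (simp add: vec_eq_iff power2_eq_square algebra_simps)
qed

text \<open>The derivative of \<open>conn_form\<close> in the base point \<open>w\<close> along
  \<open>h\<close>, with \<open>V\<close> held constant; the powers of \<open>fst w\<close> come
  from differentiating \<open>1/z\<close> and \<open>1/z^2\<close>.\<close>

definition conn_form_deriv :: "complex \<times> 'n cvec \<Rightarrow> complex \<times> 'n cvec \<Rightarrow> complex \<times> 'n cvec \<Rightarrow> 'n cmat" where
  "conn_form_deriv w V h = (\<chi> i j.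
     1 / fst w * frechet_derivative (\<lambda>q. Om q (snd V) $ j $ i) (at (snd w)) (snd h)
     - fst h / (fst w)\<^sup>2 * act (snd w) (snd V) $ i $ j
     + fst V / (fst w)\<^sup>2 * frechet_derivative (\<lambda>q. T q $ j $ i) (at (snd w)) (snd h)
     - 2 * fst V * fst h / (fst w) ^ 3 * Tt (snd w) $ i $ j
     + fst V * fst h / (fst w)\<^sup>2 * diag shift $ i $ j)"

text \<open>As \<open>Om\<close> is linear in the direction, an expansion in the standard complex
  basis reduces the claim to the product rule.\<close>

lemma has_derivative_Om_along:
  assumes p: "snd w \<in> U" and X: "(X has_derivative X') (at w)"
  shows "((\<lambda>q. Om (snd q) (X q) $ i $ j) has_derivative
    (\<lambda>h. frechet_derivative (\<lambda>q. Om q (X w) $ i $ j) (at (snd w)) (snd h) + Om (snd w) (X' h) $ i $ j)) (at w)"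
proof -
  let ?o = "\<lambda>k q. Om q (axis k 1) $ i $ j"
  have ho: "holo (*s) (\<lambda>q. Om q v $ i $ j) U" for v
    using holo_Om unfolding holo_matrix_form_def by blast
  have "((\<lambda>q. \<Sum>k\<in>UNIV. v $ k * ?o k q) has_derivative
      (\<lambda>h. \<Sum>k\<in>UNIV. v $ k * frechet_derivative (?o k) (at (snd w)) h)) (at (snd w))" for v
    by (intro has_derivative_sum has_derivative_mult_right holo_has_derivative[OF ho p])
  note sum = frechet_derivative_at[OF this, symmetric]
  have const: "frechet_derivative (\<lambda>q. Om q v $ i $ j) (at (snd w)) h =
      (\<Sum>k\<in>UNIV. v $ k * frechet_derivative (?o k) (at (snd w)) h)" for v h
    by (rule fun_cong[OF trans[OF frechet_derivative_cong_open[OF open_U p Om_expand] sum]])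
  have k: "((\<lambda>q. X q $ k * ?o k (snd q)) has_derivative
      (\<lambda>h. X w $ k * frechet_derivative (?o k) (at (snd w)) (snd h) + X' h $ k * ?o k (snd w))) (at w)" for k
    by (rule has_derivative_mult[OF bounded_linear.has_derivative[OF bounded_linear_vec_nth X]
          has_derivative_compose[OF has_derivative_snd[OF has_derivative_ident] holo_has_derivative[OF ho p]]])
  have "((\<lambda>q. \<Sum>k\<in>UNIV. X q $ k * ?o k (snd q)) has_derivative
      (\<lambda>h. frechet_derivative (\<lambda>q. Om q (X w) $ i $ j) (at (snd w)) (snd h) + Om (snd w) (X' h) $ i $ j)) (at w)"
    by (rule has_derivative_eq_rhs[OF has_derivative_sum[OF k]])
      (simp add: const[of "X w"] Om_expand[OF p, of "X' _"] sum.distrib)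
  then show ?thesis
    by (rule has_derivative_transform_within_open[of _ _ _ _ "UNIV \<times> U"])
      (use p open_U in \<open>auto simp: open_Times mem_Times_iff Om_expand[symmetric]\<close>)
qed

lemma has_derivative_conn_form:
  assumes z: "fst w \<noteq> 0" and p: "snd w \<in> U" and W: "(W has_derivative W') (at w)"
  shows "((\<lambda>q. conn_form q (W q)) has_derivative
    (\<lambda>h. conn_form_deriv w (W w) h + conn_form w (W' h))) (at w)"
  unfolding has_derivative_vec_iff
proof (intro allI)
  fix i j
  have o: "((\<lambda>q. Om (snd q) (snd (W q)) $ j $ i) has_derivative
      (\<lambda>h. frechet_derivative (\<lambda>q. Om q (snd (W w)) $ j $ i) (at (snd w)) (snd h)
        + Om (snd w) (snd (W' h)) $ j $ i)) (at w)"
    by (rule has_derivative_Om_along[OF p has_derivative_snd[OF W]])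
  have t: "((\<lambda>q. T (snd q) $ j $ i) has_derivative
      (\<lambda>h. frechet_derivative (\<lambda>q. T q $ j $ i) (at (snd w)) (snd h))) (at w)"
    by (rule has_derivative_compose[OF has_derivative_snd[OF has_derivative_ident] holo_has_derivative[OF holo_T p]])
  have r: "((\<lambda>q. inverse (fst q)) has_derivative (\<lambda>h. - fst h / (fst w)\<^sup>2)) (at w)"
    using z by (auto intro!: derivative_eq_intros simp: power2_eq_square divide_simps)
  note a = has_derivative_mult[OF has_derivative_fst[OF W] r]
  note d = has_derivative_diff[OF has_derivative_add[OF has_derivative_mult[OF r o]
        has_derivative_mult[OF has_derivative_mult[OF a r] t]] has_derivative_mult_left[OF a, of "diag shift $ i $ j"]]
  have "(\<lambda>q. conn_form q (W q) $ i $ j) = (\<lambda>q. inverse (fst q) * Om (snd q) (snd (W q)) $ j $ i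
      + fst (W q) * inverse (fst q) * inverse (fst q) * T (snd q) $ j $ i
      - fst (W q) * inverse (fst q) * diag shift $ i $ j)"
    by (simp add: fun_eq_iff conn_form_def act_nth Tt_nth divide_inverse power2_eq_square mult.assoc)
  then show "((\<lambda>q. conn_form q (W q) $ i $ j) has_derivative
      (\<lambda>h. (conn_form_deriv w (W w) h + conn_form w (W' h)) $ i $ j)) (at w)"
    using z by (simp only:, intro has_derivative_eq_rhs[OF d])
      (auto simp: conn_form_def conn_form_deriv_def act_nth Tt_nth fun_eq_iff field_simps
        power2_eq_square power3_eq_cube)
qed

text \<open>This is the exterior derivative of the connection form. Closedness of \<open>Om\<close>
  removes the \<open>1/z\<close> terms, and the terms with \<open>fst V * fst W\<close> are
  symmetric and cancel. What remains is \<open>act\<close> plus the derivative of \<open>Tt\<close>,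
  which the equation for \<open>dT\<close> turns into the commutator of \<open>act\<close> with
  \<open>diag shift\<close>.\<close>

lemma conn_form_deriv_antisym:
  assumes p: "snd w \<in> U"
  shows "conn_form_deriv w W V *v x - conn_form_deriv w V W *v x =
      (fst W / (fst w)\<^sup>2) *s (act (snd w) (snd V) *v (diag shift *v x) - diag shift *v (act (snd w) (snd V) *v x))
    - (fst V / (fst w)\<^sup>2) *s (act (snd w) (snd W) *v (diag shift *v x) - diag shift *v (act (snd w) (snd W) *v x))"
proof -
  have "conn_form_deriv w W V $ i $ j - conn_form_deriv w V W $ i $ j =
      fst W / (fst w)\<^sup>2 * (act (snd w) (snd V) ** diag shift - diag shift ** act (snd w) (snd V)) $ i $ j
    - fst V / (fst w)\<^sup>2 * (act (snd w) (snd W) ** diag shift - diag shift ** act (snd w) (snd W)) $ i $ j" for i j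
    using dOm_nth[OF p, of "snd W" j i "snd V"]
    by (simp add: conn_form_deriv_def dT_nth[OF p] diag_mult_nth act_nth shift_def)
      (simp add: divide_inverse algebra_simps)
  then have "(conn_form_deriv w W V - conn_form_deriv w V W) *v x =
      (fst W / (fst w)\<^sup>2) *s ((act (snd w) (snd V) ** diag shift - diag shift ** act (snd w) (snd V)) *v x)
    - (fst V / (fst w)\<^sup>2) *s ((act (snd w) (snd W) ** diag shift - diag shift ** act (snd w) (snd W)) *v x)"
    by (intro matrix_vector_mult_lincomb) simp
  then show ?thesis
    by (simp add: matrix_vector_mult_diff_rdistrib matrix_vector_mul_assoc)
qed

text \<open>The commutators among the values of \<open>act\<close> and of \<open>act\<close> with
  \<open>Tt\<close> vanish, that of \<open>Tt\<close> with \<open>diag shift\<close> enters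
  symmetrically in \<open>V\<close> and \<open>W\<close>, and that of \<open>act\<close> with
  \<open>diag shift\<close> cancels the exterior derivative.\<close>

lemma conn_form_flat:
  assumes z: "fst w \<noteq> 0" and p: "snd w \<in> U"
  shows "conn_form_deriv w W V *v x - conn_form_deriv w V W *v x
    + conn_form w V *v (conn_form w W *v x) - conn_form w W *v (conn_form w V *v x) = 0"
  unfolding conn_form_deriv_antisym[OF p]
  by (simp add: conn_form_mult matrix_vector_mult_diff_distrib matrix_vector_right_distrib
      vector_scalar_commute act_commute[OF p, of "snd W" "snd V"] act_T_commute[OF p] vec_eq_iff)
    (use z in \<open>simp add: field_simps power2_eq_square\<close>)

lemma saito_integrable_nabla: "saito_integrable U (ind_nabla Om) (ind_Phi Om) (ind_E T Om)"
  unfolding saito_integrable_def Let_def vector_field_prod_def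
proof (intro allI impI ballI; elim conjE)
  let ?S = "(UNIV - {0::complex}) \<times> U"
  fix V W :: "complex \<times> 'n cvec \<Rightarrow> complex \<times> 'n cvec" and Y :: "complex \<times> 'n cvec \<Rightarrow> 'n cvec"
    and w :: "complex \<times> 'n cvec"
  assume w: "w \<in> ?S" and Y: "holo_map scale_prod Y ?S"
    and V: "holo scale_prod (\<lambda>w. fst (V w)) ?S" "holo_map scale_prod (\<lambda>w. snd (V w)) ?S"
    and W: "holo scale_prod (\<lambda>w. fst (W w)) ?S" "holo_map scale_prod (\<lambda>w. snd (W w)) ?S"
  have S: "open ?S"
    by (intro open_Times open_U open_Diff) auto
  have field: "X differentiable at q"
    if "holo scale_prod (\<lambda>w. fst (X w)) ?S" "holo_map scale_prod (\<lambda>w. snd (X w)) ?S" "q \<in> ?S"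
    for X :: "complex \<times> 'n cvec \<Rightarrow> complex \<times> 'n cvec" and q
    using has_derivative_Pair[OF holo_has_derivative[OF that(1,3)] holo_map_has_derivative[OF that(2,3)]]
    by (auto simp: differentiable_def)
  have y: "holo_map scale_prod (frame Y) ?S"
  proof (rule holo_map_cong[OF S])
    show "holo_map scale_prod (\<lambda>w. phi_matrix (snd w) *v Y w) ?S"
      using Y holo_snd[OF holo_phi_matrix]
      by (auto simp: holo_map_def matrix_vector_mult_def intro!: holo_sum holo_mult)
  qed (auto simp: phi_matrix_mult)
  note sc = bounded_bilinear_scale_prod
  have z: "fst w \<noteq> 0" and p: "snd w \<in> U" using w by auto
  let ?y' = "\<lambda>q. frechet_derivative (frame Y) (at q)"
  have NY: "\<phi> (snd q) (N X Y q) = ?y' q (X q) + conn_form q (X q) *v frame Y q" if "q \<in> ?S" for q X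
    using that holo_map_differentiable[OF y that] by (intro phi_saito_nabla) auto
  have NNY: "\<phi> (snd w) (N X (N Z Y) w) =
      frechet_derivative (\<lambda>q. ?y' q (Z q)) (at w) (X w)
      + (conn_form w (Z w) *v ?y' w (X w)
        + (conn_form_deriv w (Z w) (X w) + conn_form w (frechet_derivative Z (at w) (X w))) *v frame Y w)
      + conn_form w (X w) *v (?y' w (Z w) + conn_form w (Z w) *v frame Y w)"
    if Z: "Z differentiable at w" for X Z
  proof -
    have Z': "(Z has_derivative frechet_derivative Z (at w)) (at w)"
      using Z frechet_derivative_works by blast
    have "((\<lambda>q. ?y' q (Z q)) has_derivative frechet_derivative (\<lambda>q. ?y' q (Z q)) (at w)) (at w)"
      using has_derivative_derivative_along[OF sc y S w Z'] differentiableI frechet_derivative_works by blast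
    \<comment> \<open>The formula \<open>NY\<close> holds on all of \<open>?S\<close>, which is
      open, so it can be differentiated at \<open>w\<close> by the product rule; this yields the
      differentiability required for the second use of \<open>phi_saito_nabla\<close>.\<close>
    from has_derivative_add[OF this bounded_bilinear.FDERIV[OF bounded_bilinear_matrix_vector_mult
          has_derivative_conn_form[OF z p Z'] holo_map_has_derivative[OF y w]]]
    have "(frame (N Z Y) has_derivative (\<lambda>h. frechet_derivative (\<lambda>q. ?y' q (Z q)) (at w) h
      + (conn_form w (Z w) *v ?y' w h
        + (conn_form_deriv w (Z w) h + conn_form w (frechet_derivative Z (at w) h)) *v frame Y w))) (at w)"
      by (rule has_derivative_transform_within_open[OF _ S w]) (rule NY[symmetric])
    from phi_saito_nabla[OF p differentiableI[OF this], of X] fun_cong[OF frechet_derivative_at[OF this], of "X w"]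
    show ?thesis by (simp add: NY[OF w])
  qed
  have dV: "V differentiable at w" and dW: "W differentiable at w"
    by (rule field[OF V w] field[OF W w])+
  \<comment> \<open>Second derivatives of the frame and derivatives of \<open>V\<close> and
    \<open>W\<close> are absorbed by the bracket term, and the mixed products of
    \<open>conn_form\<close> with \<open>?y'\<close> cancel; only the curvature of
    \<open>conn_form\<close> is left.\<close>
  have "\<phi> (snd w) (N V (N W Y) w - N W (N V Y) w - N (lie_bracket V W) Y w) =
      (conn_form_deriv w (W w) (V w) *v frame Y w - conn_form_deriv w (V w) (W w) *v frame Y w
       + conn_form w (V w) *v (conn_form w (W w) *v frame Y w)
       - conn_form w (W w) *v (conn_form w (V w) *v frame Y w))"
    unfolding phi_diff[OF p] NNY[OF dV] NNY[OF dW] NY[OF w] lie_bracket_def conn_form_diff[OF p]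
      derivative_along_commutator[OF sc y S w dV dW, unfolded lie_bracket_def, symmetric]
    by (simp add: matrix_vector_mult_add_rdistrib matrix_vector_mult_diff_rdistrib matrix_vector_right_distrib)
  also have "\<dots> = \<phi> (snd w) 0"
    by (simp only: conn_form_flat[OF z p] phi_zero[OF p])
  finally show "N V (N W Y) w - N W (N V Y) w - N (lie_bracket V W) Y w = 0"
    by (rule phi_eqI[OF p])
qed

lemma saito_structure_nabla:
  "saito_structure U (ind_nabla Om) (ind_Phi Om) (ind_e Om) (ind_E T Om)"
  unfolding saito_structure_def vector_field_def
  by (simp add: holo_connection_nabla flat_connection_nabla torsion_free_nabla symmetric_higgs_field_Phi
      holo_map_e holo_map_E saito_integrable_nabla nabla_e Phi_e)

end

section \<open>From the extended Okubo system to the two claims\<close>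

lemma extended_okubo_imp_okubo_equations:
  assumes "open U" "extended_okubo U T Om lam"
  shows "okubo_equations U T Om lam"
proof
  have ok: "(\<forall>i j. holo (*s) (\<lambda>p. T p $ i $ j) U) \<and> holo_matrix_form U Om \<and>
    (\<forall>i j. i \<noteq> j \<longrightarrow> lam i - lam j \<notin> \<int> - {0}) \<and>
    (\<forall>p\<in>U. \<forall>u v. T p ** Om p v - Om p v ** T p = 0 \<and> Om p u ** Om p v - Om p v ** Om p u = 0 \<and>
      frechet_derivative T (at p) v + Om p v + (Om p v ** diag lam - diag lam ** Om p v) = 0 \<and>
      ext_deriv Om p u v = 0)"
    using assms(2) unfolding extended_okubo_def by (elim conjE, intro conjI)
  note ok = ok[THEN conjunct1] ok[THEN conjunct2, THEN conjunct1]
    ok[THEN conjunct2, THEN conjunct2, THEN conjunct1] ok[THEN conjunct2, THEN conjunct2, THEN conjunct2]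
  show "holo (*s) (\<lambda>p. T p $ i $ j) U" for i j using ok(1) by simp
  show "holo_matrix_form U Om" by (rule ok(2))
  show "lam i - lam j \<notin> \<int> - {0}" if "i \<noteq> j" for i j using ok(3) that by blast
  fix p u v assume "p \<in> U"
  note eqs = ok(4)[rule_format, OF \<open>p \<in> U\<close>]
  show "T p ** Om p v = Om p v ** T p" "Om p u ** Om p v = Om p v ** Om p u"
    "frechet_derivative T (at p) v + Om p v + (Om p v ** diag lam - diag lam ** Om p v) = 0"
    "ext_deriv Om p u v = 0"
    using eqs by simp_all
qed (rule assms(1))

theorem theorem4p20:
  fixes U :: "('n::{finite,linorder}) cvec set"
    and T :: "'n cvec \<Rightarrow> 'n cmat"
    and Om :: "'n cvec \<Rightarrow> 'n cvec \<Rightarrow> 'n cmat"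
    and lam :: "'n \<Rightarrow> complex"
  assumes "open U" and "connected U" and "U \<noteq> {}" and "simply_connected U"
    and "extended_okubo U T Om lam"
  shows "(induces_saito_structure U T Om \<longleftrightarrow>
            (\<forall>p\<in>U. wedge UNIV (\<lambda>j. frechet_derivative (\<lambda>q. T q $ last_index $ j) (at p)) \<noteq> (\<lambda>_. 0)))
       \<and> ((\<forall>p\<in>U. wedge UNIV (\<lambda>j. frechet_derivative (\<lambda>q. T q $ last_index $ j) (at p)) \<noteq> (\<lambda>_. 0)) \<longrightarrow>
            flat_coordinates U (ind_nabla Om)
              (\<lambda>j p. - inverse (lam j - lam last_index + 1) * T p $ last_index $ j))"
proof -
  interpret okubo_equations U T Om lam
    by (rule extended_okubo_imp_okubo_equations) fact+
  \<comment> \<open>Inducing a Saito structure includes bijectivity of \<open>\<phi>\<close>, which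
    is equivalent to the wedge condition; conversely bijectivity makes all axioms and the flat
    coordinates available.\<close>
  have "okubo_frame U T Om lam" if "\<forall>p\<in>U. bij (ind_phi Om p)"
    using that by unfold_locales blast
  then show ?thesis
    using okubo_frame.saito_structure_nabla okubo_frame.flat_coordinates_nabla
    by (auto simp: induces_saito_structure_def wedge_dT_nonzero_iff)
qed

end
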